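(* Let $n\ge1$, $\varepsilon\ne0$, let $\Omega\subseteq\mathbb{R}^{2n}$ be a bounded domain, $H\in C^1(\overline\Omega)$ and $\sigma\in[0,1]$, and let $u\in C^3(\Omega)\cap C^1(\overline\Omega)$ solve $$\operatorname{div}\left(\frac{Du+\sigma X}{\sqrt{\varepsilon^2+|Du+\sigma X|^2}}\right)=\sigma H\quad\text{in }\Omega.$$ Then there exists $C>0$ depending only on $n,\varepsilon,\|u\|_{L^\infty(\Omega)},\|H\|_{C^1(\overline\Omega)},\|X\|_{L^\infty(\Omega)}$ (thus independent of $\sigma\in[0,1]$) such that $$\|Du\|_{L^\infty(\Omega)}\le C\left(\|Du\|_{L^\infty(\partial\Omega)}+1\right).$$
   Context: Points of $\mathbb{R}^{2n}$ are $z=(x,y)$, $x,y\in\mathbb{R}^n$; $X(x,y)=(-y,x)$. $D$, $|\cdot|$, $\operatorname{div}$ are Euclidean. *)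

theory Defs
  imports "HOL-Analysis.Analysis"
begin

text \<open>Points of R^(2n) are pairs z = (x,y) with x, y in R^n (R^n = real^'n).\<close>

definition Xfield :: "((real^'n) \<times> (real^'n)) \<Rightarrow> ((real^'n) \<times> (real^'n))" where
  "Xfield z = (- snd z, fst z)"

definition grad :: "('a::euclidean_space \<Rightarrow> real) \<Rightarrow> 'a \<Rightarrow> 'a" where
  "grad u z = (\<Sum>b\<in>Basis. frechet_derivative u (at z) b *\<^sub>R b)"

definition divergence :: "('a::euclidean_space \<Rightarrow> 'a) \<Rightarrow> 'a \<Rightarrow> real" where
  "divergence F z = (\<Sum>b\<in>Basis. frechet_derivative F (at z) b \<bullet> b)"

fun Ck_on :: "nat \<Rightarrow> ('a::euclidean_space \<Rightarrow> 'b::real_normed_vector) \<Rightarrow> 'a set \<Rightarrow> bool" where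
  "Ck_on 0 f S = continuous_on S f"
| "Ck_on (Suc k) f S = (continuous_on S f \<and> f differentiable_on S \<and>
      (\<forall>b\<in>Basis. Ck_on k (\<lambda>z. frechet_derivative f (at z) b) S))"

definition C1_closure_ext :: "('a::euclidean_space \<Rightarrow> real) \<Rightarrow> ('a \<Rightarrow> 'a) \<Rightarrow> 'a set \<Rightarrow> bool" where
  "C1_closure_ext u G \<Omega> = (Ck_on 1 u \<Omega> \<and> continuous_on (closure \<Omega>) u \<and>
      continuous_on (closure \<Omega>) G \<and> (\<forall>z\<in>\<Omega>. G z = grad u z))"

end

theory Submission
  imports Defs
begin

text \<open>
  Bernstein's method, applied to the auxiliary function \<open>|Du| exp (\<beta> u)\<close>; here \<open>X\<close> and \<open>H\<close> stand for
  \<open>\<sigma> X\<close> and \<open>\<sigma> H\<close>. Let \<open>z\<close> be an interior maximum and write \<open>g = Du(z)\<close>, \<open>A = D\<^sup>2u(z)\<close>,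
  \<open>p = g + X(z)\<close>, \<open>s = g \<cdot> p\<close>, \<open>W\<^sup>2 = \<epsilon>\<^sup>2 + |p|\<^sup>2\<close> and \<open>Q(L) = W\<^sup>2 tr L - p \<cdot> L p\<close> for linear maps
  \<open>L\<close>. Since \<open>X\<close> is skew, the equation reads \<open>Q(A) = H W\<^sup>3\<close>. By the first order condition, \<open>g\<close> is an
  eigenvector of \<open>A\<close> with eigenvalue \<open>- \<beta> |g|\<^sup>2\<close>, so that \<open>A = R - \<beta> g g\<^sup>T\<close> with \<open>R g = 0\<close>. By the
  second order condition, a linear map involving third derivatives of \<open>u\<close> is nonpositive. Applying
  \<open>Q\<close> to it and eliminating the third derivatives by means of the equation differentiated in
  direction \<open>g\<close> gives \<open>Q(R\<^sup>2) + \<beta>\<^sup>2 |g|\<^sup>2 Q(g g\<^sup>T) (2 s / W\<^sup>2 - 1) \<le> error\<close>. Here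
  \<open>Q(g g\<^sup>T) \<ge> \<epsilon>\<^sup>2 |g|\<^sup>2\<close>, and \<open>s / W\<^sup>2\<close> is close to 1 when \<open>|g|\<close> is large, so the second summand is
  at least \<open>\<beta>\<^sup>2 \<epsilon>\<^sup>2 |g|\<^sup>4 / 2\<close>. Up to lower order terms and terms absorbed by \<open>Q(R\<^sup>2)\<close>, the error is
  at most \<open>|g|\<^sup>4\<close> times a coefficient that is only affine in \<open>\<beta>\<close>. For \<open>\<beta>\<close> large in terms of the data
  this bounds \<open>|g|\<close>; otherwise the maximum lies on the boundary.
\<close>

section \<open>Second derivatives\<close>

lemma has_real_derivative_along_line:
  fixes f :: "'a::real_normed_vector \<Rightarrow> real"
  assumes "(f has_derivative D) (at (x + r *\<^sub>R h))"
  shows "((\<lambda>r. f (x + r *\<^sub>R h)) has_real_derivative D h) (at r)"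
proof -
  have "((\<lambda>r. x + r *\<^sub>R h) has_derivative (\<lambda>s. s *\<^sub>R h)) (at r)"
    by (auto intro!: derivative_eq_intros)
  from has_derivative_compose[OF this assms] show ?thesis
    using linear_scale[OF has_derivative_linear[OF assms]]
    by (simp add: has_field_derivative_def mult.commute[of _ "D h"])
qed

lemma second_difference_mvt:
  fixes f :: "'a::real_normed_vector \<Rightarrow> real"
  assumes "0 < t"
    and f': "\<And>r q. r \<in> {0..t} \<Longrightarrow> q \<in> {0..t} \<Longrightarrow>
      (f has_derivative f' (z + r *\<^sub>R h + q *\<^sub>R k)) (at (z + r *\<^sub>R h + q *\<^sub>R k))"
  obtains r where "0 < r" "r < t"
    "f (z + t *\<^sub>R h + t *\<^sub>R k) - f (z + t *\<^sub>R h) - f (z + t *\<^sub>R k) + f z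
      = t * (f' (z + r *\<^sub>R h + t *\<^sub>R k) h - f' (z + r *\<^sub>R h) h)"
proof -
  have along: "((\<lambda>r. f (z + r *\<^sub>R h + q *\<^sub>R k)) has_real_derivative f' (z + r *\<^sub>R h + q *\<^sub>R k) h)
    (at r)"
    if "r \<in> {0..t}" "q \<in> {0..t}" for r q
    using has_real_derivative_along_line[of f _ "z + q *\<^sub>R k" r h] f'[OF that] by (simp add: add_ac)
  define \<phi> where "\<phi> r = f (z + r *\<^sub>R h + t *\<^sub>R k) - f (z + r *\<^sub>R h + 0 *\<^sub>R k)" for r
  have "\<exists>r. 0 < r \<and> r < t \<and>
      \<phi> t - \<phi> 0 = (t - 0) * (f' (z + r *\<^sub>R h + t *\<^sub>R k) h - f' (z + r *\<^sub>R h + 0 *\<^sub>R k) h)"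
    unfolding \<phi>_def using \<open>0 < t\<close> by (intro MVT2 DERIV_diff along) auto
  then show thesis
    using that by (auto simp: \<phi>_def algebra_simps)
qed

lemma norm_nonneg_combination_le:
  fixes h k :: "'a::real_normed_vector"
  assumes "r \<in> {0..t}" "q \<in> {0..t}"
  shows "norm (r *\<^sub>R h + q *\<^sub>R k) \<le> t * (norm h + norm k)"
proof -
  have "norm (r *\<^sub>R h + q *\<^sub>R k) \<le> r * norm h + q * norm k"
    using norm_triangle_ineq[of "r *\<^sub>R h" "q *\<^sub>R k"] assms by simp
  also have "\<dots> \<le> t * norm h + t * norm k"
    using assms by (intro add_mono mult_right_mono) auto
  finally show ?thesis by (simp add: distrib_left)
qed

lemma eventually_nhds_parallelogram:
  fixes z h k :: "'a::real_normed_vector"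
  assumes "\<forall>\<^sub>F x in nhds z. P x"
  shows "\<forall>\<^sub>F t in at_right 0. \<forall>r\<in>{0..t}. \<forall>q\<in>{0..t}. P (z + r *\<^sub>R h + q *\<^sub>R k)"
proof -
  obtain d where "d > 0" and P: "\<And>x. norm (x - z) < d \<Longrightarrow> P x"
    using assms unfolding eventually_nhds_metric dist_norm by blast
  have "((\<lambda>t. t * (norm h + norm k)) \<longlongrightarrow> 0 * (norm h + norm k)) (at_right 0)"
    by (intro tendsto_intros)
  then have "\<forall>\<^sub>F t in at_right 0. t * (norm h + norm k) < d"
    using \<open>d > 0\<close> by (intro order_tendstoD(2)) auto
  then show ?thesis
  proof eventually_elim
    case (elim t)
    then show ?case
      using norm_nonneg_combination_le[of _ t _ h k]
      by (intro ballI P) (simp add: add.assoc, meson le_less_trans)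
  qed
qed

lemma has_derivative_increment_uniform:
  fixes f :: "'a::real_normed_vector \<Rightarrow> real"
  assumes f': "(f has_derivative D) (at z)" and "e > 0"
  shows "\<forall>\<^sub>F t in at_right 0. \<forall>r\<in>{0..t}. \<bar>f (z + r *\<^sub>R h + t *\<^sub>R k) - f (z + r *\<^sub>R h) - t * D k\<bar>
    \<le> e * t"
proof -
  define C where "C = 2 * (norm h + norm k) + 1"
  have "C > 0" by (simp add: C_def add_nonneg_pos)
  interpret D: bounded_linear D using f' by (rule has_derivative_bounded_linear)
  have "\<forall>\<^sub>F x in nhds z. \<bar>f x - f z - D (x - z)\<bar> \<le> (e / C) * norm (x - z)"
    using f' divide_pos_pos[OF \<open>e > 0\<close> \<open>C > 0\<close>]
    unfolding has_derivative_at_alt eventually_nhds_metric dist_norm real_norm_def by blast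
  from eventually_nhds_parallelogram[OF this, of h k] eventually_at_right_less[of 0]
  show ?thesis
  proof eventually_elim
    case (elim t)
    have approx: "\<bar>f (z + r *\<^sub>R h + q *\<^sub>R k) - f z - (r * D h + q * D k)\<bar>
      \<le> (e / C) * (t * (norm h + norm k))"
      if "r \<in> {0..t}" "q \<in> {0..t}" for r q
    proof -
      have "\<bar>f (z + r *\<^sub>R h + q *\<^sub>R k) - f z - D (r *\<^sub>R h + q *\<^sub>R k)\<bar>
        \<le> (e / C) * norm (r *\<^sub>R h + q *\<^sub>R k)"
        using bspec[OF bspec[OF elim(1) that(1)] that(2)] by (simp add: add.assoc)
      also have "\<dots> \<le> (e / C) * (t * (norm h + norm k))"
        using norm_nonneg_combination_le[OF that] \<open>e > 0\<close> \<open>C > 0\<close> by (intro mult_left_mono) auto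
      finally show ?thesis by (simp add: D.add D.scaleR)
    qed
    have "\<bar>f (z + r *\<^sub>R h + t *\<^sub>R k) - f (z + r *\<^sub>R h) - t * D k\<bar> \<le> e * t" if "r \<in> {0..t}" for r
    proof -
      have "\<bar>f (z + r *\<^sub>R h + t *\<^sub>R k) - f (z + r *\<^sub>R h) - t * D k\<bar>
        \<le> 2 * ((e / C) * (t * (norm h + norm k)))"
        using approx[of r t] approx[of r 0] that elim(2) by simp
      also have "\<dots> = (e / C) * (t * (C - 1))" by (simp add: C_def)
      also have "\<dots> \<le> (e / C) * (t * C)"
        using \<open>e > 0\<close> \<open>C > 0\<close> elim(2) by (intro mult_left_mono) auto
      finally show ?thesis using \<open>C > 0\<close> by simp
    qed
    then show ?case by blast
  qed
qed

lemma second_difference_quotient_tendsto: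
  fixes f :: "'a::real_normed_vector \<Rightarrow> real"
  assumes f': "\<forall>\<^sub>F x in nhds z. (f has_derivative f' x) (at x)"
    and f'': "((\<lambda>x. f' x h) has_derivative D) (at z)"
  shows "((\<lambda>t. (f (z + t *\<^sub>R h + t *\<^sub>R k) - f (z + t *\<^sub>R h) - f (z + t *\<^sub>R k) + f z) / t\<^sup>2)
    \<longlongrightarrow> D k) (at_right 0)"
proof (rule tendstoI)
  fix e :: real assume "e > 0"
  then have "\<forall>\<^sub>F t in at_right 0. \<forall>r\<in>{0..t}.
      \<bar>f' (z + r *\<^sub>R h + t *\<^sub>R k) h - f' (z + r *\<^sub>R h) h - t * D k\<bar> \<le> (e / 2) * t"
    by (intro has_derivative_increment_uniform[OF f'']) simp
  with eventually_nhds_parallelogram[OF f', of h k] eventually_at_right_less[of 0]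
  show "\<forall>\<^sub>F t in at_right 0. dist
    ((f (z + t *\<^sub>R h + t *\<^sub>R k) - f (z + t *\<^sub>R h) - f (z + t *\<^sub>R k) + f z) / t\<^sup>2) (D k) < e"
  proof eventually_elim
    case (elim t)
    obtain r where r: "0 < r" "r < t"
      "f (z + t *\<^sub>R h + t *\<^sub>R k) - f (z + t *\<^sub>R h) - f (z + t *\<^sub>R k) + f z
        = t * (f' (z + r *\<^sub>R h + t *\<^sub>R k) h - f' (z + r *\<^sub>R h) h)"
      using second_difference_mvt[OF elim(2), of f f' z h k] elim(1) by blast
    let ?\<Delta> = "f' (z + r *\<^sub>R h + t *\<^sub>R k) h - f' (z + r *\<^sub>R h) h"
    have "t * ?\<Delta> / t\<^sup>2 - D k = (?\<Delta> - t * D k) / t"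
      using elim(2) by (simp add: power2_eq_square diff_divide_distrib)
    then have "dist (t * ?\<Delta> / t\<^sup>2) (D k) = \<bar>?\<Delta> - t * D k\<bar> / t"
      using elim(2) by (simp add: dist_real_def)
    also have "\<dots> \<le> e / 2"
      using elim(2,3) r(1,2) by (simp add: pos_divide_le_eq)
    also have "\<dots> < e" using \<open>e > 0\<close> by simp
    finally show ?case unfolding r(3) .
  qed
qed

lemma second_derivative_symmetric:
  fixes f :: "'a::real_normed_vector \<Rightarrow> real"
  assumes f': "\<forall>\<^sub>F x in nhds z. (f has_derivative f' x) (at x)"
    and h: "((\<lambda>x. f' x h) has_derivative D\<^sub>h) (at z)"
    and k: "((\<lambda>x. f' x k) has_derivative D\<^sub>k) (at z)"
  shows "D\<^sub>h k = D\<^sub>k h"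
proof (rule tendsto_unique[OF _ second_difference_quotient_tendsto[OF f' h]])
  have swap: "f (z + t *\<^sub>R k + t *\<^sub>R h) - f (z + t *\<^sub>R k) - f (z + t *\<^sub>R h)
      = f (z + t *\<^sub>R h + t *\<^sub>R k) - f (z + t *\<^sub>R h) - f (z + t *\<^sub>R k)" for t
  proof -
    have "z + t *\<^sub>R k + t *\<^sub>R h = z + t *\<^sub>R h + t *\<^sub>R k" by simp
    then show ?thesis by (simp only:)
  qed
  show "((\<lambda>t. (f (z + t *\<^sub>R h + t *\<^sub>R k) - f (z + t *\<^sub>R h) - f (z + t *\<^sub>R k) + f z) / t\<^sup>2)
    \<longlongrightarrow> D\<^sub>k h) (at_right 0)"
    using second_difference_quotient_tendsto[OF f' k, of h] by (simp only: swap)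
qed simp

lemma second_derivative_nonpos_at_max:
  fixes f :: "'a::real_normed_vector \<Rightarrow> real"
  assumes S: "open S" "z \<in> S" and max: "\<And>x. x \<in> S \<Longrightarrow> f x \<le> f z"
    and f': "\<And>x. x \<in> S \<Longrightarrow> (f has_derivative f' x) (at x)"
    and f'': "((\<lambda>x. f' x h) has_derivative D) (at z)"
  shows "D h \<le> 0"
proof -
  have "\<forall>\<^sub>F x in nhds z. (f has_derivative f' x) (at x)"
    using S f' eventually_nhds by blast
  then have "((\<lambda>t.
      (f (z + t *\<^sub>R h + t *\<^sub>R (- h)) - f (z + t *\<^sub>R h) - f (z + t *\<^sub>R (- h)) + f z) / t\<^sup>2)
    \<longlongrightarrow> D (- h)) (at_right 0)"
    using f'' by (rule second_difference_quotient_tendsto)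
  moreover have "\<forall>\<^sub>F t in at_right 0.
      0 \<le> (f (z + t *\<^sub>R h + t *\<^sub>R (- h)) - f (z + t *\<^sub>R h) - f (z + t *\<^sub>R (- h)) + f z) / t\<^sup>2"
  proof -
    have near: "\<forall>\<^sub>F t in at_right 0. z + t *\<^sub>R k \<in> S" for k
    proof -
      have "((\<lambda>t. z + t *\<^sub>R k) \<longlongrightarrow> z + 0 *\<^sub>R k) (at_right 0)" by (intro tendsto_intros)
      then show ?thesis using S by (intro topological_tendstoD) auto
    qed
    show ?thesis
      using near[of h] near[of "- h"]
    proof eventually_elim
      case (elim t)
      show ?case using max[OF elim(1)] max[OF elim(2)] by simp
    qed
  qed
  ultimately have "0 \<le> D (- h)"
    by (intro tendsto_lowerbound) auto
  then show ?thesis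
    using linear_neg[OF has_derivative_linear[OF f'']] by simp
qed

section \<open>Calculus of \<open>C\<^sup>k\<close> functions\<close>

lemma linear_Basis_sum:
  fixes f :: "'a::euclidean_space \<Rightarrow> 'b::real_vector"
  assumes "linear f"
  shows "f h = (\<Sum>b\<in>Basis. (h \<bullet> b) *\<^sub>R f b)"
proof -
  have "f h = f (\<Sum>b\<in>Basis. (h \<bullet> b) *\<^sub>R b)" by (simp add: euclidean_representation)
  also have "\<dots> = (\<Sum>b\<in>Basis. (h \<bullet> b) *\<^sub>R f b)"
    by (simp add: linear_sum[OF assms] linear_scale[OF assms])
  finally show ?thesis .
qed

lemma Ck_on_Suc_has_derivative:
  assumes "Ck_on (Suc k) f S" "open S" "x \<in> S"
  shows "(f has_derivative frechet_derivative f (at x)) (at x)"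
  using assms
  by (auto simp: differentiable_on_eq_differentiable_at frechet_derivative_works[symmetric])

lemma Ck_on_mono:
  assumes "Ck_on k f S" "j \<le> k"
  shows "Ck_on j f S"
  using assms
proof (induction k arbitrary: j f)
  case (Suc k)
  then show ?case by (cases j) auto
qed simp

lemma Ck_on_cong:
  assumes "open S" "Ck_on k f S" "\<And>x. x \<in> S \<Longrightarrow> f x = g x"
  shows "Ck_on k g S"
  using assms(2,3)
proof (induction k arbitrary: f g)
  case 0
  then show ?case by (simp cong: continuous_on_cong)
next
  case (Suc k)
  have "(f has_derivative frechet_derivative f (at x)) (at x)" if "x \<in> S" for x
    using Suc.prems(1) \<open>open S\<close> that by (rule Ck_on_Suc_has_derivative)
  then have g': "(g has_derivative frechet_derivative f (at x)) (at x)" if "x \<in> S" for x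
    using that \<open>open S\<close> Suc.prems(2) by (blast intro: has_derivative_transform_within_open)
  have "Ck_on k (\<lambda>x. frechet_derivative g (at x) b) S" if "b \<in> Basis" for b
  proof (rule Suc.IH)
    show "Ck_on k (\<lambda>x. frechet_derivative f (at x) b) S"
      using Suc.prems(1) that by simp
    show "frechet_derivative f (at x) b = frechet_derivative g (at x) b" if "x \<in> S" for x
      using frechet_derivative_at[OF g'[OF that]] by simp
  qed
  moreover have "g differentiable_on S"
    using g' \<open>open S\<close> by (auto simp: differentiable_on_eq_differentiable_at differentiable_def)
  ultimately show ?case
    by (auto simp: differentiable_imp_continuous_on)
qed

lemma Ck_on_bounded_linear:
  assumes "bounded_linear L" "open S" "Ck_on k f S"
  shows "Ck_on k (\<lambda>x. L (f x)) S"
  using assms(3)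
proof (induction k arbitrary: f)
  case 0
  then show ?case using assms(1) by (auto intro: bounded_linear.continuous_on)
next
  case (Suc k)
  have Lf': "((\<lambda>x. L (f x)) has_derivative (\<lambda>h. L (frechet_derivative f (at x) h))) (at x)"
    if "x \<in> S" for x
    using assms(1) Ck_on_Suc_has_derivative[OF Suc.prems \<open>open S\<close> that]
    by (rule bounded_linear.has_derivative)
  have "Ck_on k (\<lambda>x. frechet_derivative (\<lambda>x. L (f x)) (at x) b) S" if "b \<in> Basis" for b
  proof (rule Ck_on_cong[OF \<open>open S\<close>])
    show "Ck_on k (\<lambda>x. L (frechet_derivative f (at x) b)) S"
      using Suc that by auto
  qed (simp flip: frechet_derivative_at[OF Lf'])
  moreover have "(\<lambda>x. L (f x)) differentiable_on S"
    using Lf' \<open>open S\<close> by (auto simp: differentiable_on_eq_differentiable_at differentiable_def)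
  ultimately show ?case
    by (auto simp: differentiable_imp_continuous_on)
qed

lemma Ck_on_sum:
  assumes "open S" "\<And>i. i \<in> I \<Longrightarrow> Ck_on k (f i) S"
  shows "Ck_on k (\<lambda>x. \<Sum>i\<in>I. f i x) S"
  using assms(2)
proof (induction k arbitrary: f)
  case 0
  then show ?case by (auto intro: continuous_on_sum)
next
  case (Suc k)
  have sum': "((\<lambda>x. \<Sum>i\<in>I. f i x) has_derivative (\<lambda>h. \<Sum>i\<in>I. frechet_derivative (f i) (at x) h))
    (at x)"
    if "x \<in> S" for x
    using Suc.prems \<open>open S\<close> that by (intro has_derivative_sum Ck_on_Suc_has_derivative)
  have "Ck_on k (\<lambda>x. frechet_derivative (\<lambda>x. \<Sum>i\<in>I. f i x) (at x) b) S" if "b \<in> Basis" for b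
  proof (rule Ck_on_cong[OF \<open>open S\<close>])
    show "Ck_on k (\<lambda>x. \<Sum>i\<in>I. frechet_derivative (f i) (at x) b) S"
      using Suc.prems that by (intro Suc.IH) auto
  qed (simp flip: frechet_derivative_at[OF sum'])
  moreover have "(\<lambda>x. \<Sum>i\<in>I. f i x) differentiable_on S"
    using sum' \<open>open S\<close> by (auto simp: differentiable_on_eq_differentiable_at differentiable_def)
  ultimately show ?case
    by (auto simp: differentiable_imp_continuous_on)
qed

lemma Ck_on_directional_derivative:
  assumes "open S" "Ck_on (Suc k) f S"
  shows "Ck_on k (\<lambda>x. frechet_derivative f (at x) h) S"
proof (rule Ck_on_cong[OF \<open>open S\<close>])
  show "Ck_on k (\<lambda>x. \<Sum>b\<in>Basis. (h \<bullet> b) *\<^sub>R frechet_derivative f (at x) b) S"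
    using assms by (intro Ck_on_sum Ck_on_bounded_linear[OF bounded_linear_scaleR_right]) auto
qed (rule linear_Basis_sum[symmetric,
    OF has_derivative_linear[OF Ck_on_Suc_has_derivative[OF assms(2,1)]]])

lemma Ck_on_grad:
  assumes "open S" "Ck_on (Suc k) u S"
  shows "Ck_on k (grad u) S"
  unfolding grad_def using assms
  by (intro Ck_on_sum Ck_on_bounded_linear[OF bounded_linear_scaleR_left]) auto

lemma has_derivative_grad:
  fixes u :: "'a::euclidean_space \<Rightarrow> real"
  assumes "u differentiable (at z)"
  shows "(u has_derivative (\<lambda>h. grad u z \<bullet> h)) (at z)"
proof -
  have "frechet_derivative u (at z) h = grad u z \<bullet> h" for h
    using linear_Basis_sum[OF linear_frechet_derivative[OF assms], of h]
    by (simp add: grad_def inner_sum_left inner_commute[of h] mult.commute)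
  then have "frechet_derivative u (at z) = (\<lambda>h. grad u z \<bullet> h)" ..
  with assms show ?thesis by (simp add: frechet_derivative_works)
qed

lemma grad_cmult:
  assumes "u differentiable (at z)"
  shows "grad (\<lambda>x. c * u x) z = c *\<^sub>R grad u z"
proof -
  have "((\<lambda>x. c * u x) has_derivative (\<lambda>h. c * frechet_derivative u (at z) h)) (at z)"
    using assms by (intro has_derivative_mult_right) (simp add: frechet_derivative_works)
  then show ?thesis
    by (simp add: grad_def scaleR_sum_right flip: frechet_derivative_at)
qed

definition hessian :: "('a::euclidean_space \<Rightarrow> real) \<Rightarrow> 'a \<Rightarrow> 'a \<Rightarrow> 'a" where
  "hessian u z = frechet_derivative (grad u) (at z)"

definition third_derivative :: "('a::euclidean_space \<Rightarrow> real) \<Rightarrow> 'a \<Rightarrow> 'a \<Rightarrow> 'a \<Rightarrow> 'a" where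
  "third_derivative u z h k = frechet_derivative (\<lambda>x. hessian u x k) (at z) h"

context
  fixes u :: "'a::euclidean_space \<Rightarrow> real" and S
  assumes S: "open S" and Ck_on_2: "Ck_on 2 u S"
begin

lemma has_derivative_grad_on:
  assumes "z \<in> S"
  shows "(u has_derivative (\<lambda>h. grad u z \<bullet> h)) (at z)"
  using Ck_on_2 S assms
  by (intro has_derivative_grad) (auto simp: numeral_2_eq_2 differentiable_on_eq_differentiable_at)

lemma grad_has_derivative_hessian:
  assumes "z \<in> S"
  shows "(grad u has_derivative hessian u z) (at z)"
  unfolding hessian_def
  by (rule Ck_on_Suc_has_derivative[OF Ck_on_grad[OF S Ck_on_2[unfolded numeral_2_eq_2]] S assms])

lemma linear_hessian: "z \<in> S \<Longrightarrow> linear (hessian u z)"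
  using grad_has_derivative_hessian has_derivative_linear by blast

lemma hessian_symmetric:
  assumes "z \<in> S"
  shows "hessian u z h \<bullet> k = h \<bullet> hessian u z k"
proof -
  have "((\<lambda>x. grad u x \<bullet> h) has_derivative (\<lambda>k. hessian u z k \<bullet> h)) (at z)" for h
    using assms by (intro has_derivative_inner_left grad_has_derivative_hessian)
  moreover have "\<forall>\<^sub>F x in nhds z. (u has_derivative (\<lambda>h. grad u x \<bullet> h)) (at x)"
    using S assms has_derivative_grad_on eventually_nhds by blast
  ultimately have "hessian u z k \<bullet> h = hessian u z h \<bullet> k"
    using second_derivative_symmetric[of u "\<lambda>x h. grad u x \<bullet> h"] by blast
  then show ?thesis by (simp add: inner_commute)
qed

end

context
  fixes u :: "'a::euclidean_space \<Rightarrow> real" and S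
  assumes S: "open S" and Ck_on_3: "Ck_on 3 u S"
begin

lemma hessian_has_derivative:
  assumes "z \<in> S"
  shows "((\<lambda>x. hessian u x k) has_derivative (\<lambda>h. third_derivative u z h k)) (at z)"
  unfolding third_derivative_def
proof (rule Ck_on_Suc_has_derivative[OF _ S assms])
  show "Ck_on (Suc 0) (\<lambda>x. hessian u x k) S"
    unfolding hessian_def
    by (rule Ck_on_directional_derivative[OF S Ck_on_grad[OF S Ck_on_3[unfolded numeral_3_eq_3]]])
qed

lemma third_derivative_commute:
  assumes "z \<in> S"
  shows "third_derivative u z h k = third_derivative u z k h"
proof (rule vector_eq_rdot[THEN iffD1], intro allI)
  fix m
  have "((\<lambda>x. hessian u x h \<bullet> m) has_derivative (\<lambda>k. third_derivative u z k h \<bullet> m)) (at z)" for h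
    using assms by (intro has_derivative_inner_left hessian_has_derivative)
  moreover have "((\<lambda>x. grad u x \<bullet> m) has_derivative (\<lambda>h. hessian u x h \<bullet> m)) (at x)"
    if "x \<in> S" for x
    using S Ck_on_mono[OF Ck_on_3] that
    by (intro has_derivative_inner_left grad_has_derivative_hessian) auto
  then have "\<forall>\<^sub>F x in nhds z. ((\<lambda>x. grad u x \<bullet> m) has_derivative (\<lambda>h. hessian u x h \<bullet> m)) (at x)"
    using S assms eventually_nhds by blast
  ultimately show "third_derivative u z h k \<bullet> m = third_derivative u z k h \<bullet> m"
    using second_derivative_symmetric[of "\<lambda>x. grad u x \<bullet> m" "\<lambda>x h. hessian u x h \<bullet> m"] by blast
qed

lemma third_derivative_symmetric:
  assumes "z \<in> S"
  shows "third_derivative u z h k \<bullet> m = third_derivative u z h m \<bullet> k"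
proof -
  have "((\<lambda>x. hessian u x k \<bullet> m) has_derivative (\<lambda>h. third_derivative u z h m \<bullet> k)) (at z)"
  proof (rule has_derivative_transform_within_open[OF _ S assms])
    show "((\<lambda>x. hessian u x m \<bullet> k) has_derivative (\<lambda>h. third_derivative u z h m \<bullet> k)) (at z)"
      using assms by (intro has_derivative_inner_left hessian_has_derivative)
    show "hessian u x m \<bullet> k = hessian u x k \<bullet> m" if "x \<in> S" for x
      using hessian_symmetric[OF S Ck_on_mono[OF Ck_on_3] that] by (simp add: inner_commute)
  qed
  moreover have "((\<lambda>x. hessian u x k \<bullet> m) has_derivative (\<lambda>h. third_derivative u z h k \<bullet> m)) (at z)"
    using assms by (intro has_derivative_inner_left hessian_has_derivative)
  ultimately show ?thesis
    using has_derivative_unique by metis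
qed

lemma linear_third_derivative:
  assumes "z \<in> S"
  shows "linear (third_derivative u z h)"
proof -
  have "linear (\<lambda>k. third_derivative u z k h)"
    using hessian_has_derivative[OF assms] by (rule has_derivative_linear)
  moreover have "(\<lambda>k. third_derivative u z k h) = third_derivative u z h"
    using third_derivative_commute[OF assms] by blast
  ultimately show ?thesis by simp
qed

end

section \<open>The mean curvature operator in nondivergence form\<close>

definition operator_trace :: "('a::euclidean_space \<Rightarrow> 'a) \<Rightarrow> real" where
  "operator_trace L = (\<Sum>b\<in>Basis. L b \<bullet> b)"

lemma divergence_eq_operator_trace:
  assumes "(F has_derivative F') (at z)"
  shows "divergence F z = operator_trace F'"
  using frechet_derivative_at[OF assms] by (simp add: divergence_def operator_trace_def)

definition area_element :: "real \<Rightarrow> 'a::real_normed_vector \<Rightarrow> real" where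
  "area_element e p = sqrt (e\<^sup>2 + (norm p)\<^sup>2)"

lemma area_element_power2: "(area_element e p)\<^sup>2 = e\<^sup>2 + p \<bullet> p" for p :: "'a::real_inner"
  by (simp add: area_element_def power2_norm_eq_inner)

lemma area_element_pos: "e \<noteq> 0 \<Longrightarrow> 0 < area_element e p"
  by (simp add: area_element_def add_pos_nonneg)

lemma norm_le_area_element: "norm p \<le> area_element e p"
  by (simp add: area_element_def real_le_rsqrt)

lemma area_element_le: "area_element e p \<le> \<bar>e\<bar> + norm p"
  using sqrt_sum_squares_le_sum_abs[of e "norm p"] by (simp add: area_element_def)

lemma has_derivative_area_element:
  fixes p :: "'a::real_normed_vector \<Rightarrow> 'b::real_inner"
  assumes p: "(p has_derivative P) (at z)" and "e \<noteq> 0"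
  shows "((\<lambda>x. area_element e (p x)) has_derivative (\<lambda>h. (p z \<bullet> P h) / area_element e (p z)))
    (at z)"
proof -
  have pos: "e\<^sup>2 + p z \<bullet> p z > 0" using \<open>e \<noteq> 0\<close> by (simp add: add_pos_nonneg)
  have "((\<lambda>x. e\<^sup>2 + p x \<bullet> p x) has_derivative (\<lambda>h. 2 * (p z \<bullet> P h))) (at z)"
    using p by (auto intro!: derivative_eq_intros simp: inner_commute)
  from has_derivative_real_sqrt[OF pos this] show ?thesis
    by (simp add: area_element_def power2_norm_eq_inner field_simps)
qed

definition mean_curvature_form :: "real \<Rightarrow> 'a::euclidean_space \<Rightarrow> ('a \<Rightarrow> 'a) \<Rightarrow> real" where
  "mean_curvature_form e p L = (area_element e p)\<^sup>2 * operator_trace L - p \<bullet> L p"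

lemma mean_curvature_form_add:
  "mean_curvature_form e p (\<lambda>h. L h + M h) = mean_curvature_form e p L + mean_curvature_form e p M"
  by (simp add: mean_curvature_form_def operator_trace_def sum.distrib algebra_simps)

lemma mean_curvature_form_scaleR:
  "mean_curvature_form e p (\<lambda>h. c *\<^sub>R L h) = c * mean_curvature_form e p L"
  by (simp add: mean_curvature_form_def operator_trace_def right_diff_distrib
      flip: sum_distrib_left)

lemma mean_curvature_form_rank_one:
  "mean_curvature_form e p (\<lambda>h. (g \<bullet> h) *\<^sub>R g) = (area_element e p)\<^sup>2 * (g \<bullet> g) - (g \<bullet> p)\<^sup>2"
  by (simp add: mean_curvature_form_def operator_trace_def euclidean_inner[of g g]
      inner_commute[of p] power2_eq_square)

lemma area_element_Cauchy_Schwarz: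
  "e\<^sup>2 * (g \<bullet> g) \<le> (area_element e p)\<^sup>2 * (g \<bullet> g) - (g \<bullet> p)\<^sup>2"
  using Cauchy_Schwarz_ineq[of g p] by (simp add: area_element_power2 algebra_simps)

lemma Lagrange_identity_linear:
  fixes p :: "'a::euclidean_space"
  assumes L: "linear L"
  defines "n \<equiv> \<lambda>b c. (p \<bullet> b) *\<^sub>R c - (p \<bullet> c) *\<^sub>R b"
  shows "(\<Sum>b\<in>Basis. \<Sum>c\<in>Basis. L (n b c) \<bullet> n b c) = 2 * ((p \<bullet> p) * operator_trace L - p \<bullet> L p)"
proof -
  have trace: "(\<Sum>b\<in>Basis. \<Sum>c\<in>Basis. (p \<bullet> b)\<^sup>2 * (L c \<bullet> c)) = (p \<bullet> p) * operator_trace L"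
    by (simp add: operator_trace_def euclidean_inner[of p p] sum_product power2_eq_square)
  have quadratic: "(\<Sum>b\<in>Basis. \<Sum>c\<in>Basis. (p \<bullet> b) * (p \<bullet> c) * (L b \<bullet> c)) = p \<bullet> L p"
  proof -
    have "p \<bullet> L p = (\<Sum>b\<in>Basis. (p \<bullet> b) * (\<Sum>c\<in>Basis. (p \<bullet> c) * (L b \<bullet> c)))"
      using Linear_Algebra.linear_componentwise[OF L, of p p] euclidean_inner[of p "L _"]
      by (simp add: inner_commute[of p "L _"])
    then show ?thesis by (simp add: sum_distrib_left mult.assoc)
  qed
  have "L (n b c) \<bullet> n b c = (p \<bullet> b)\<^sup>2 * (L c \<bullet> c) + (p \<bullet> c)\<^sup>2 * (L b \<bullet> b)
      - (p \<bullet> c) * (p \<bullet> b) * (L c \<bullet> b) - (p \<bullet> b) * (p \<bullet> c) * (L b \<bullet> c)" for b c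
    by (simp add: n_def linear_diff[OF L] linear_scale[OF L] power2_eq_square algebra_simps)
  then have "(\<Sum>b\<in>Basis. \<Sum>c\<in>Basis. L (n b c) \<bullet> n b c)
    = (p \<bullet> p) * operator_trace L + (\<Sum>b\<in>Basis. \<Sum>c\<in>Basis. (p \<bullet> c)\<^sup>2 * (L b \<bullet> b))
      - (\<Sum>b\<in>Basis. \<Sum>c\<in>Basis. (p \<bullet> c) * (p \<bullet> b) * (L c \<bullet> b)) - p \<bullet> L p"
    by (simp add: sum.distrib sum_subtractf quadratic trace)
  also have "(\<Sum>b\<in>Basis. \<Sum>c\<in>Basis. (p \<bullet> c)\<^sup>2 * (L b \<bullet> b)) = (p \<bullet> p) * operator_trace L"
    by (subst sum.swap) (rule trace)
  also have "(\<Sum>b\<in>Basis. \<Sum>c\<in>Basis. (p \<bullet> c) * (p \<bullet> b) * (L c \<bullet> b)) = p \<bullet> L p"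
    by (subst sum.swap) (rule quadratic)
  finally show ?thesis by simp
qed

lemma mean_curvature_form_nonpos:
  assumes L: "linear L" and neg: "\<And>h. L h \<bullet> h \<le> 0"
  shows "mean_curvature_form e p L \<le> 0"
proof -
  have "2 * ((p \<bullet> p) * operator_trace L - p \<bullet> L p) \<le> 0"
    unfolding Lagrange_identity_linear[OF L, symmetric] by (intro sum_nonpos neg)
  moreover have "e\<^sup>2 * operator_trace L \<le> 0"
    unfolding operator_trace_def by (intro mult_nonneg_nonpos sum_nonpos neg) simp
  ultimately show ?thesis
    by (simp add: mean_curvature_form_def area_element_power2 distrib_right)
qed

lemma divergence_normalized_field:
  fixes p :: "'a::euclidean_space \<Rightarrow> 'a"
  assumes p: "(p has_derivative P) (at z)" and "e \<noteq> 0"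
  shows "divergence (\<lambda>w. (1 / area_element e (p w)) *\<^sub>R p w) z * area_element e (p z) ^ 3
    = mean_curvature_form e (p z) P"
proof -
  define W where "W = area_element e (p z)"
  have "W > 0" using \<open>e \<noteq> 0\<close> by (simp add: W_def area_element_pos)
  have "((\<lambda>w. (1 / area_element e (p w)) *\<^sub>R p w) has_derivative
      (\<lambda>h. (1 / W) *\<^sub>R P h - ((p z \<bullet> P h) / W ^ 3) *\<^sub>R p z)) (at z)"
    by (rule has_derivative_eq_rhs[OF has_derivative_scaleR[OF has_derivative_divide[OF
        has_derivative_const has_derivative_area_element[OF p \<open>e \<noteq> 0\<close>]] p]])
      (use \<open>W > 0\<close> in \<open>auto simp: fun_eq_iff W_def power3_eq_cube divide_simps\<close>)
  then have "divergence (\<lambda>w. (1 / area_element e (p w)) *\<^sub>R p w) z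
      = operator_trace (\<lambda>h. (1 / W) *\<^sub>R P h - ((p z \<bullet> P h) / W ^ 3) *\<^sub>R p z)"
    by (rule divergence_eq_operator_trace)
  also have "\<dots> = operator_trace P / W - (\<Sum>b\<in>Basis. (p z \<bullet> b) * (p z \<bullet> P b)) / W ^ 3"
    by (simp add: operator_trace_def inner_diff_left sum_subtractf sum_divide_distrib mult.commute)
  also have "(\<Sum>b\<in>Basis. (p z \<bullet> b) * (p z \<bullet> P b)) = p z \<bullet> P (p z)"
    using Linear_Algebra.linear_componentwise[OF has_derivative_linear[OF p], of "p z" "p z"]
    by (simp add: inner_commute)
  finally show ?thesis
    using \<open>W > 0\<close>
    by (simp add: mean_curvature_form_def field_simps power2_eq_square power3_eq_cube flip: W_def)
qed

lemma has_derivative_linear_family_apply: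
  fixes A :: "'a::real_normed_vector \<Rightarrow> 'b::euclidean_space \<Rightarrow> 'c::real_normed_vector"
  assumes S: "open S" "z \<in> S" and lin: "\<And>x. x \<in> S \<Longrightarrow> linear (A x)" "\<And>h. linear (A' h)"
    and A: "\<And>k. ((\<lambda>x. A x k) has_derivative (\<lambda>h. A' h k)) (at z)"
    and p: "(p has_derivative P) (at z)"
  shows "((\<lambda>x. A x (p x)) has_derivative (\<lambda>h. A' h (p z) + A z (P h))) (at z)"
proof (rule has_derivative_transform_within_open[OF _ S])
  have "((\<lambda>x. \<Sum>b\<in>Basis. (p x \<bullet> b) *\<^sub>R A x b) has_derivative
    (\<lambda>h. \<Sum>b\<in>Basis. (p z \<bullet> b) *\<^sub>R A' h b + (P h \<bullet> b) *\<^sub>R A z b)) (at z)"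
    by (intro has_derivative_sum has_derivative_scaleR has_derivative_inner_left p A)
  also have "(\<lambda>h. \<Sum>b\<in>Basis. (p z \<bullet> b) *\<^sub>R A' h b + (P h \<bullet> b) *\<^sub>R A z b)
    = (\<lambda>h. A' h (p z) + A z (P h))"
    using lin(2) lin(1)[OF S(2)] by (simp add: sum.distrib flip: linear_Basis_sum)
  finally show "((\<lambda>x. \<Sum>b\<in>Basis. (p x \<bullet> b) *\<^sub>R A x b) has_derivative
    (\<lambda>h. A' h (p z) + A z (P h))) (at z)" .
  show "(\<Sum>b\<in>Basis. (p x \<bullet> b) *\<^sub>R A x b) = A x (p x)" if "x \<in> S" for x
    by (rule linear_Basis_sum[OF lin(1)[OF that], symmetric])
qed

lemma has_derivative_mean_curvature_form:
  fixes p :: "'a::euclidean_space \<Rightarrow> 'a"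
  assumes S: "open S" "z \<in> S" and lin: "\<And>x. x \<in> S \<Longrightarrow> linear (A x)" "\<And>h. linear (A' h)"
    and A: "\<And>k. ((\<lambda>x. A x k) has_derivative (\<lambda>h. A' h k)) (at z)"
    and p: "(p has_derivative P) (at z)"
  shows "((\<lambda>x. mean_curvature_form e (p x) (A x)) has_derivative
    (\<lambda>h. mean_curvature_form e (p z) (A' h) + 2 * (p z \<bullet> P h) * operator_trace (A z)
      - (P h \<bullet> A z (p z) + p z \<bullet> A z (P h)))) (at z)"
proof -
  have "((\<lambda>x. operator_trace (A x)) has_derivative (\<lambda>h. operator_trace (A' h))) (at z)"
    unfolding operator_trace_def by (intro has_derivative_sum has_derivative_inner_left A)
  then show ?thesis
    unfolding mean_curvature_form_def area_element_power2
    using p has_derivative_linear_family_apply[OF S lin A p]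
    by (auto intro!: derivative_eq_intros simp: inner_commute algebra_simps)
qed

definition hilbert_schmidt_norm :: "('a::euclidean_space \<Rightarrow> 'b::real_normed_vector) \<Rightarrow> real" where
  "hilbert_schmidt_norm L = L2_set (\<lambda>b. norm (L b)) Basis"

lemma hilbert_schmidt_norm_nonneg: "0 \<le> hilbert_schmidt_norm L"
  by (simp add: hilbert_schmidt_norm_def)

lemma norm_le_hilbert_schmidt_norm:
  assumes "linear L"
  shows "norm (L y) \<le> hilbert_schmidt_norm L * norm y"
proof -
  have "norm (L y) \<le> (\<Sum>b\<in>Basis. \<bar>y \<bullet> b\<bar> * \<bar>norm (L b)\<bar>)"
    by (subst linear_Basis_sum[OF assms]) (rule sum_norm_le, simp)
  also have "\<dots> \<le> L2_set (\<lambda>b. y \<bullet> b) Basis * hilbert_schmidt_norm L"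
    unfolding hilbert_schmidt_norm_def by (rule L2_set_mult_ineq)
  also have "L2_set (\<lambda>b. y \<bullet> b) Basis = norm y"
    by (simp add: L2_set_def norm_eq_sqrt_inner euclidean_inner[of y y] power2_eq_square)
  finally show ?thesis by (simp add: mult.commute)
qed

lemma mean_curvature_form_square:
  assumes sym: "\<And>h k. R h \<bullet> k = h \<bullet> R k"
  shows "mean_curvature_form e p (\<lambda>h. R (R h))
    = (area_element e p)\<^sup>2 * (hilbert_schmidt_norm R)\<^sup>2 - (norm (R p))\<^sup>2"
proof -
  have "R (R h) \<bullet> h = (norm (R h))\<^sup>2" for h
    using sym[of "R h" h] by (simp add: power2_norm_eq_inner)
  then show ?thesis
    by (simp add: mean_curvature_form_def operator_trace_def hilbert_schmidt_norm_def L2_set_def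
        sum_nonneg inner_commute[of p])
qed

section \<open>An interior maximum of \<open>|Du| exp (\<beta> u)\<close>\<close>

locale bernstein_maximum =
  fixes u :: "'a::euclidean_space \<Rightarrow> real" and S z \<beta>
  assumes open_domain: "open S" and in_domain: "z \<in> S" and Ck_on_3: "Ck_on 3 u S"
    and maximum: "\<And>x. x \<in> S \<Longrightarrow> norm (grad u x) * exp (\<beta> * u x) \<le> norm (grad u z) * exp (\<beta> * u z)"
begin

abbreviation "g \<equiv> grad u z"
abbreviation "A \<equiv> hessian u z"
abbreviation "T \<equiv> third_derivative u z"

lemma Ck_on_2: "Ck_on 2 u S"
  using Ck_on_3 by (rule Ck_on_mono) simp

lemmas hessian_linear = linear_hessian[OF open_domain Ck_on_2]
lemmas hessian_symmetric_at_max = hessian_symmetric[OF open_domain Ck_on_2 in_domain]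

definition bernstein_function :: "'a \<Rightarrow> real" where
  "bernstein_function x = (grad u x \<bullet> grad u x) * exp (2 * \<beta> * u x)"

definition bernstein_function_derivative :: "'a \<Rightarrow> 'a \<Rightarrow> real" where
  "bernstein_function_derivative x h = 2 * exp (2 * \<beta> * u x) *
    (grad u x \<bullet> hessian u x h + \<beta> * (grad u x \<bullet> grad u x) * (grad u x \<bullet> h))"

lemma bernstein_function_has_derivative:
  assumes "x \<in> S"
  shows "(bernstein_function has_derivative bernstein_function_derivative x) (at x)"
  unfolding bernstein_function_def bernstein_function_derivative_def
  by (rule has_derivative_eq_rhs,
      (rule derivative_intros has_derivative_grad_on[OF open_domain Ck_on_2 assms]
        grad_has_derivative_hessian[OF open_domain Ck_on_2 assms])+)
    (simp add: fun_eq_iff inner_commute algebra_simps)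

lemma bernstein_function_le:
  assumes "x \<in> S"
  shows "bernstein_function x \<le> bernstein_function z"
proof -
  have "bernstein_function y = (norm (grad u y) * exp (\<beta> * u y))\<^sup>2" for y
    by (simp add: bernstein_function_def power_mult_distrib power2_norm_eq_inner
        exp_double[symmetric] mult.assoc)
  then show ?thesis
    using power_mono[OF maximum[OF assms], of 2]
    by (simp only: mult_nonneg_nonneg norm_ge_zero exp_ge_zero)
qed

lemma hessian_gradient: "A g = (- \<beta> * (g \<bullet> g)) *\<^sub>R g"
proof (rule vector_eq_ldot[THEN iffD1], intro allI)
  fix h
  have "bernstein_function_derivative z = (\<lambda>h. 0)"
    using differential_zero_maxmin[OF in_domain open_domain
        bernstein_function_has_derivative[OF in_domain]]
      bernstein_function_le by blast
  then have "g \<bullet> A h + \<beta> * (g \<bullet> g) * (g \<bullet> h) = 0"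
    by (simp add: bernstein_function_derivative_def fun_eq_iff)
  then show "h \<bullet> A g = h \<bullet> ((- \<beta> * (g \<bullet> g)) *\<^sub>R g)"
    using hessian_symmetric_at_max[of h g] by (simp add: inner_commute)
qed

lemma second_order_condition:
  "A h \<bullet> A h + T g h \<bullet> h + \<beta> * (g \<bullet> g) * (A h \<bullet> h) - 2 * \<beta>\<^sup>2 * (g \<bullet> g) * (g \<bullet> h)\<^sup>2 \<le> 0"
proof -
  have gA: "g \<bullet> A k = - \<beta> * (g \<bullet> g) * (g \<bullet> k)" for k
    using hessian_symmetric_at_max[of k g] by (simp add: hessian_gradient inner_commute)
  let ?E = "\<lambda>k. 2 * exp (2 * \<beta> * u z) * (A k \<bullet> A h + g \<bullet> T k h
      + \<beta> * (2 * (g \<bullet> A k) * (g \<bullet> h) + (g \<bullet> g) * (A k \<bullet> h)))"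
  have "((\<lambda>x. bernstein_function_derivative x h) has_derivative ?E) (at z)"
    unfolding bernstein_function_derivative_def
    by (rule has_derivative_eq_rhs,
        (rule derivative_intros has_derivative_grad_on[OF open_domain Ck_on_2 in_domain]
          grad_has_derivative_hessian[OF open_domain Ck_on_2 in_domain]
          hessian_has_derivative[OF open_domain Ck_on_3 in_domain])+)
      (simp add: fun_eq_iff gA inner_commute algebra_simps)
  with open_domain in_domain bernstein_function_le bernstein_function_has_derivative have "?E h \<le> 0"
    by (rule second_derivative_nonpos_at_max)
  then have "A h \<bullet> A h + g \<bullet> T h h + \<beta> * (2 * (g \<bullet> A h) * (g \<bullet> h) + (g \<bullet> g) * (A h \<bullet> h)) \<le> 0"
    by (simp add: mult_le_0_iff)
  moreover have "g \<bullet> T h h = T g h \<bullet> h"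
    using third_derivative_symmetric[OF open_domain Ck_on_3 in_domain, of h h g]
      third_derivative_commute[OF open_domain Ck_on_3 in_domain, of h g]
    by (simp add: inner_commute)
  ultimately show ?thesis
    by (simp add: gA power2_eq_square algebra_simps)
qed

definition reduced_hessian :: "'a \<Rightarrow> 'a"  (\<open>R\<close>) where
  "R h = A h + (\<beta> * (g \<bullet> h)) *\<^sub>R g"

lemma hessian_eq_reduced: "A h = R h - (\<beta> * (g \<bullet> h)) *\<^sub>R g"
  by (simp add: reduced_hessian_def)

lemma linear_reduced_hessian: "linear R"
  using hessian_linear[OF in_domain]
  by (auto intro!: linearI simp: reduced_hessian_def linear_add linear_scale algebra_simps)

lemma reduced_hessian_symmetric: "R h \<bullet> k = h \<bullet> R k"
  using hessian_symmetric_at_max[of h k]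
  by (simp add: reduced_hessian_def inner_commute[of h g] algebra_simps)

lemma reduced_hessian_gradient: "R g = 0"
  by (simp add: reduced_hessian_def hessian_gradient flip: scaleR_add_left)

lemma inner_gradient_reduced_hessian: "g \<bullet> R h = 0"
  using reduced_hessian_symmetric[of g h] by (simp add: reduced_hessian_gradient)

lemma second_order_contracted:
  "mean_curvature_form e p (\<lambda>h. R (R h)) + mean_curvature_form e p (T g)
    + \<beta> * (g \<bullet> g) * mean_curvature_form e p A
    - \<beta>\<^sup>2 * (g \<bullet> g) * ((area_element e p)\<^sup>2 * (g \<bullet> g) - (g \<bullet> p)\<^sup>2) \<le> 0"
proof -
  define B where "B h = R (R h) + T g h + (\<beta> * (g \<bullet> g)) *\<^sub>R A h
    + (- \<beta>\<^sup>2 * (g \<bullet> g)) *\<^sub>R (g \<bullet> h) *\<^sub>R g" for h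
  have "linear B"
    unfolding B_def using linear_reduced_hessian hessian_linear[OF in_domain]
      linear_third_derivative[OF open_domain Ck_on_3 in_domain, of g]
    by (intro linearI) (simp_all add: linear_add linear_scale algebra_simps)
  moreover have "B h \<bullet> h \<le> 0" for h
  proof -
    have "A h \<bullet> A h = R (R h) \<bullet> h + \<beta>\<^sup>2 * (g \<bullet> g) * (g \<bullet> h)\<^sup>2"
      by (simp add: hessian_eq_reduced inner_diff_left inner_diff_right
          inner_gradient_reduced_hessian inner_commute[of "R _" g]
          reduced_hessian_symmetric[of "R h"] power2_eq_square)
    then show ?thesis
      using second_order_condition[of h] by (simp add: B_def power2_eq_square algebra_simps)
  qed
  ultimately have "mean_curvature_form e p B \<le> 0" by (rule mean_curvature_form_nonpos)
  then show ?thesis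
    unfolding B_def mean_curvature_form_add mean_curvature_form_scaleR mean_curvature_form_rank_one
    by (simp add: algebra_simps)
qed

end

locale mean_curvature_maximum = bernstein_maximum u S z \<beta>
  for u :: "'a::euclidean_space \<Rightarrow> real" and S z \<beta> +
  fixes X :: "'a \<Rightarrow> 'a" and H :: "'a \<Rightarrow> real" and e :: real
  assumes e_nonzero: "e \<noteq> 0" and linear_X: "linear X" and skew_X: "\<And>h. X h \<bullet> h = 0"
    and H_differentiable: "H differentiable (at z)"
    and equation: "\<And>x. x \<in> S \<Longrightarrow>
      divergence (\<lambda>w. (1 / area_element e (grad u w + X w)) *\<^sub>R (grad u w + X w)) x = H x"
begin

abbreviation "p \<equiv> g + X z"
abbreviation "W \<equiv> area_element e p"
abbreviation "s \<equiv> g \<bullet> p"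

lemma flux_has_derivative:
  assumes "x \<in> S"
  shows "((\<lambda>x. grad u x + X x) has_derivative (\<lambda>h. hessian u x h + X h)) (at x)"
  using assms linear_X
  by (intro has_derivative_add grad_has_derivative_hessian[OF open_domain Ck_on_2]
      linear_imp_has_derivative)

lemma nondivergence_equation:
  assumes "x \<in> S"
  shows "mean_curvature_form e (grad u x + X x) (hessian u x)
    = H x * area_element e (grad u x + X x) ^ 3"
proof -
  have "mean_curvature_form e q X = 0" for q
    by (simp add: mean_curvature_form_def operator_trace_def skew_X inner_commute[of q])
  then show ?thesis
    using divergence_normalized_field[OF flux_has_derivative[OF assms] e_nonzero] equation[OF assms]
    by (simp add: mean_curvature_form_add)
qed

lemma linearized_equation:
  "mean_curvature_form e p (T h) + 2 * (p \<bullet> (A h + X h)) * operator_trace A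
    - 2 * ((A h + X h) \<bullet> A p)
    = (grad H z \<bullet> h) * W ^ 3 + 3 * H z * W * (p \<bullet> (A h + X h))"
proof -
  let ?F = "\<lambda>x. mean_curvature_form e (grad u x + X x) (hessian u x)"
  have "(?F has_derivative (\<lambda>h. mean_curvature_form e p (T h)
      + 2 * (p \<bullet> (A h + X h)) * operator_trace A - ((A h + X h) \<bullet> A p + p \<bullet> A (A h + X h)))) (at z)"
    using in_domain
    by (intro has_derivative_mean_curvature_form[where S=S] open_domain hessian_linear
        linear_third_derivative[OF open_domain Ck_on_3] hessian_has_derivative[OF open_domain Ck_on_3]
        flux_has_derivative)
  moreover have "(?F has_derivative (\<lambda>h. (grad H z \<bullet> h) * W ^ 3 + 3 * H z * W * (p \<bullet> (A h + X h))))
    (at z)"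
  proof (rule has_derivative_transform_within_open[OF _ open_domain in_domain])
    show "((\<lambda>x. H x * area_element e (grad u x + X x) ^ 3) has_derivative
        (\<lambda>h. (grad H z \<bullet> h) * W ^ 3 + 3 * H z * W * (p \<bullet> (A h + X h)))) (at z)"
      by (rule has_derivative_eq_rhs[OF has_derivative_mult[OF
            has_derivative_grad[OF H_differentiable]
            has_derivative_power[OF has_derivative_area_element[OF
                flux_has_derivative[OF in_domain] e_nonzero]]]])
        (use area_element_pos[OF e_nonzero, of p] in \<open>simp add: fun_eq_iff eval_nat_numeral\<close>)
  qed (simp add: nondivergence_equation)
  ultimately have "mean_curvature_form e p (T h) + 2 * (p \<bullet> (A h + X h)) * operator_trace A
      - ((A h + X h) \<bullet> A p + p \<bullet> A (A h + X h))
    = (grad H z \<bullet> h) * W ^ 3 + 3 * H z * W * (p \<bullet> (A h + X h))"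
    by (rule has_derivative_unique[THEN fun_cong])
  then show ?thesis
    using hessian_symmetric_at_max[of "A h + X h" p] by (simp add: inner_commute)
qed

definition curvature_error :: real where
  "curvature_error = (grad H z \<bullet> g) * W ^ 3 + \<beta> * (g \<bullet> g) * H z * W * (W\<^sup>2 - s)
    + H z * W * (X z \<bullet> X g)"

definition coupling_error :: real where
  "coupling_error = 2 * (X z \<bullet> R (X z)) * (\<beta> * (g \<bullet> g) * (s / W\<^sup>2) - X z \<bullet> X g / W\<^sup>2)
    + 2 * \<beta> * (s / W\<^sup>2) * s * (X z \<bullet> X g) + 2 * (X g \<bullet> R (X z))"

lemma hessian_flux: "A p = R (X z) - (\<beta> * s) *\<^sub>R g"
  using reduced_hessian_gradient
  by (simp add: hessian_eq_reduced linear_add[OF linear_reduced_hessian])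

lemma flux_hessian_flux: "p \<bullet> A p = X z \<bullet> R (X z) - \<beta> * s\<^sup>2"
  by (simp add: hessian_flux inner_diff_right inner_add_left[of _ _ "R _"]
      inner_gradient_reduced_hessian inner_commute[of p g] power2_eq_square)

lemma gradient_inner_X_gradient: "g \<bullet> X g = 0"
  using skew_X[of g] by (simp add: inner_commute)

lemma flux_inner_flux_derivative: "p \<bullet> (A g + X g) = X z \<bullet> X g - \<beta> * (g \<bullet> g) * s"
  by (simp add: hessian_gradient gradient_inner_X_gradient inner_commute[of "X z" g] algebra_simps)

lemma flux_derivative_hessian_flux: "(A g + X g) \<bullet> A p = \<beta>\<^sup>2 * (g \<bullet> g)\<^sup>2 * s + X g \<bullet> R (X z)"
  using gradient_inner_X_gradient
  by (simp add: hessian_flux hessian_gradient inner_diff_left inner_diff_right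
      inner_gradient_reduced_hessian inner_commute[of "X g" g] power2_eq_square)

lemma bernstein_inequality:
  "W\<^sup>2 * (hilbert_schmidt_norm R)\<^sup>2 - (norm (R (X z)))\<^sup>2
    + \<beta>\<^sup>2 * (g \<bullet> g) * (W\<^sup>2 * (g \<bullet> g) - s\<^sup>2) * (2 * (s / W\<^sup>2) - 1)
    \<le> - (curvature_error + coupling_error)"
proof -
  define w \<eta> \<kappa> \<tau> i where "w = g \<bullet> g" and "\<eta> = X z \<bullet> X g" and "\<kappa> = X z \<bullet> R (X z)"
    and "\<tau> = X g \<bullet> R (X z)" and "i = 1 / W\<^sup>2"
  have inverse_square: "i * W\<^sup>2 = 1" using area_element_pos[OF e_nonzero, of p] by (simp add: i_def)
  have "W\<^sup>2 * operator_trace A - (\<kappa> - \<beta> * s\<^sup>2) = H z * W ^ 3"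
    using nondivergence_equation[OF in_domain]
    by (simp add: mean_curvature_form_def flux_hessian_flux \<kappa>_def)
  then have trace: "operator_trace A = H z * W + (\<kappa> - \<beta> * s\<^sup>2) * i"
    using inverse_square by algebra
  have contracted: "W\<^sup>2 * (hilbert_schmidt_norm R)\<^sup>2 - (norm (R (X z)))\<^sup>2
      + mean_curvature_form e p (T g) + \<beta> * w * (H z * W ^ 3) - \<beta>\<^sup>2 * w * (W\<^sup>2 * w - s\<^sup>2) \<le> 0"
    using second_order_contracted[of e p] reduced_hessian_gradient
    by (simp add: mean_curvature_form_square reduced_hessian_symmetric
        linear_add[OF linear_reduced_hessian] nondivergence_equation[OF in_domain] flip: w_def)
  have linearized: "mean_curvature_form e p (T g) + 2 * (\<eta> - \<beta> * w * s) * operator_trace A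
      - 2 * (\<beta>\<^sup>2 * w\<^sup>2 * s + \<tau>) = (grad H z \<bullet> g) * W ^ 3 + 3 * H z * W * (\<eta> - \<beta> * w * s)"
    using linearized_equation[of g]
    unfolding flux_inner_flux_derivative flux_derivative_hessian_flux w_def \<eta>_def \<tau>_def .
  have error: "curvature_error + coupling_error
    = (grad H z \<bullet> g) * W ^ 3 + \<beta> * w * H z * W * (W\<^sup>2 - s) + H z * W * \<eta>
      + 2 * \<kappa> * (\<beta> * w * (s * i) - \<eta> * i) + 2 * \<beta> * (s * i) * s * \<eta> + 2 * \<tau>"
    by (simp add: curvature_error_def coupling_error_def w_def \<eta>_def \<kappa>_def \<tau>_def i_def)
  have "\<beta>\<^sup>2 * w * (W\<^sup>2 * w - s\<^sup>2) * (2 * (s * i) - 1) + (curvature_error + coupling_error)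
    = mean_curvature_form e p (T g) + \<beta> * w * (H z * W ^ 3) - \<beta>\<^sup>2 * w * (W\<^sup>2 * w - s\<^sup>2)"
    using linearized trace inverse_square unfolding error by algebra
  with contracted show ?thesis by (simp add: w_def i_def)
qed

end

section \<open>Estimates for a large gradient\<close>

lemma abs_mult_le:
  fixes a b :: "'a::linordered_idom"
  assumes "\<bar>a\<bar> \<le> A" "\<bar>b\<bar> \<le> B"
  shows "\<bar>a * b\<bar> \<le> A * B"
  unfolding abs_mult using assms by (intro mult_mono) auto

lemma abs_inner_le:
  assumes "norm x \<le> M" "norm y \<le> N"
  shows "\<bar>x \<bullet> y\<bar> \<le> M * N"
proof -
  have "\<bar>x \<bullet> y\<bar> \<le> norm x * norm y" by (rule Cauchy_Schwarz_ineq2)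
  also have "\<dots> \<le> M * N"
    using assms order_trans[OF norm_ge_zero assms(1)] by (intro mult_mono) auto
  finally show ?thesis .
qed

definition defect_bound :: "real \<Rightarrow> real \<Rightarrow> real" where
  "defect_bound e L = e\<^sup>2 + L + L\<^sup>2"

locale large_vector_perturbation =
  fixes g Y :: "'a::euclidean_space" and e L :: real
  assumes perturbation: "norm Y \<le> L" and one_le: "1 \<le> norm g"
    and large: "16 * defect_bound e L \<le> norm g"
begin

abbreviation "area \<equiv> area_element e (g + Y)"

lemma L_nonneg: "0 \<le> L"
  using perturbation norm_ge_zero[of Y] by linarith

lemma norm_perturbation_le: "norm Y \<le> norm g / 16"
  using perturbation large zero_le_power2[of e] zero_le_power2[of L]
  unfolding defect_bound_def by argo

lemma area_element_bounds:
  "norm g / 2 \<le> area" "area \<le> 2 * norm g"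
proof -
  have "norm g / 2 \<le> norm g - norm Y" using norm_perturbation_le one_le by linarith
  also have "\<dots> \<le> norm (g + Y)" using norm_triangle_ineq2[of g "- Y"] by simp
  also have "\<dots> \<le> area" by (rule norm_le_area_element)
  finally show "norm g / 2 \<le> area" .
  have "e\<^sup>2 \<le> norm g / 16" using large L_nonneg zero_le_power2[of L]
    unfolding defect_bound_def by argo
  also have "\<dots> \<le> (norm g / 2)\<^sup>2" using self_le_power[OF one_le, of 2] one_le
    by (simp add: power_divide)
  finally have "\<bar>e\<bar> \<le> norm g / 2" by (simp add: abs_le_square_iff[symmetric])
  moreover have "norm (g + Y) \<le> norm g + norm g / 16"
    using norm_triangle_ineq[of g Y] norm_perturbation_le by linarith
  ultimately show "area \<le> 2 * norm g"
    using area_element_le[of e "g + Y"] one_le by linarith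
qed

lemma large_area_element_pos: "0 < area"
  using area_element_bounds(1) one_le by linarith

lemma abs_divide_area_element_le:
  assumes "\<bar>x\<bar> \<le> B"
  shows "\<bar>x / area\<^sup>2\<bar> \<le> B * 4 / (norm g)\<^sup>2"
proof -
  have "(norm g / 2)\<^sup>2 \<le> area\<^sup>2"
    using area_element_bounds(1) by (intro power_mono) auto
  then have "\<bar>x\<bar> / area\<^sup>2 \<le> B / (norm g / 2)\<^sup>2"
    using assms one_le by (intro frac_le) auto
  then show ?thesis by (simp add: power_divide)
qed

lemma area_element_defect:
  "\<bar>area\<^sup>2 - g \<bullet> (g + Y)\<bar> \<le> defect_bound e L * norm g"
proof -
  have "area\<^sup>2 - g \<bullet> (g + Y) = e\<^sup>2 + Y \<bullet> g + Y \<bullet> Y"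
    by (simp add: area_element_power2 inner_add_left inner_add_right)
  moreover have "\<bar>Y \<bullet> g\<bar> \<le> L * norm g" and "\<bar>Y \<bullet> Y\<bar> \<le> L * L"
    using perturbation by (intro abs_inner_le; simp)+
  ultimately have "\<bar>area\<^sup>2 - g \<bullet> (g + Y)\<bar> \<le> e\<^sup>2 + L * norm g + L\<^sup>2"
    using zero_le_power2[of e] unfolding power2_eq_square[of L] abs_le_iff by linarith
  also have "\<dots> \<le> e\<^sup>2 * norm g + L * norm g + L\<^sup>2 * norm g"
    using one_le by (intro add_mono mult_le_cancel_left1[THEN iffD2]) auto
  finally show ?thesis by (simp add: defect_bound_def distrib_right)
qed

lemma inner_ratio_bounds:
  "3 / 4 \<le> g \<bullet> (g + Y) / area\<^sup>2"
  "g \<bullet> (g + Y) / area\<^sup>2 \<le> 5 / 4"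
proof -
  let ?V = "area\<^sup>2"
  have "\<bar>(?V - g \<bullet> (g + Y)) / ?V\<bar> \<le> defect_bound e L * norm g * 4 / (norm g)\<^sup>2"
    by (intro abs_divide_area_element_le area_element_defect)
  also have "\<dots> \<le> 1 / 4"
    using large one_le by (auto simp: power2_eq_square divide_simps)
  finally have "\<bar>1 - g \<bullet> (g + Y) / ?V\<bar> \<le> 1 / 4"
    using large_area_element_pos by (simp add: diff_divide_distrib)
  then show "3 / 4 \<le> g \<bullet> (g + Y) / ?V" "g \<bullet> (g + Y) / ?V \<le> 5 / 4" by linarith+
qed

lemma abs_inner_le_twice_square: "\<bar>g \<bullet> (g + Y)\<bar> \<le> 2 * (norm g)\<^sup>2"
proof -
  have "\<bar>g \<bullet> (g + Y)\<bar> \<le> norm g * (2 * norm g)"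
    using norm_triangle_ineq[of g Y] norm_perturbation_le one_le by (intro abs_inner_le) auto
  then show ?thesis by (simp add: power2_eq_square)
qed

lemma inner_perturbation_ratio_le:
  assumes "norm q \<le> norm g"
  shows "\<bar>Y \<bullet> q / area\<^sup>2\<bar> \<le> 1"
proof -
  have "\<bar>Y \<bullet> q / area\<^sup>2\<bar> \<le> norm g / 16 * norm g * 4 / (norm g)\<^sup>2"
    using norm_perturbation_le assms by (intro abs_divide_area_element_le abs_inner_le)
  also have "\<dots> \<le> 1" by (simp add: power2_eq_square)
  finally show ?thesis .
qed

lemma leading_coefficient_ge:
  "e\<^sup>2 / 2 * (norm g)\<^sup>2 \<le> (area\<^sup>2 * (g \<bullet> g) - (g \<bullet> (g + Y))\<^sup>2)
    * (2 * (g \<bullet> (g + Y) / area\<^sup>2) - 1)"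
proof -
  have "1 / 2 \<le> 2 * (g \<bullet> (g + Y) / area\<^sup>2) - 1"
    using inner_ratio_bounds(1) by linarith
  then have "e\<^sup>2 * (g \<bullet> g) * (1 / 2) \<le> (area\<^sup>2 * (g \<bullet> g) - (g \<bullet> (g + Y))\<^sup>2)
      * (2 * (g \<bullet> (g + Y) / area\<^sup>2) - 1)"
    by (intro mult_mono area_element_Cauchy_Schwarz order_trans[OF _ area_element_Cauchy_Schwarz])
      auto
  then show ?thesis by (simp add: power2_norm_eq_inner)
qed

lemma norm_image_perturbation_le:
  assumes "linear R"
  shows "norm (R Y) \<le> hilbert_schmidt_norm R * L"
  using norm_le_hilbert_schmidt_norm[OF assms, of Y]
    mult_left_mono[OF perturbation hilbert_schmidt_norm_nonneg[of R]] by linarith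

lemma square_term_ge:
  assumes "linear R"
  shows "(hilbert_schmidt_norm R)\<^sup>2 * (norm g)\<^sup>2 / 8
    \<le> area\<^sup>2 * (hilbert_schmidt_norm R)\<^sup>2 - (norm (R Y))\<^sup>2"
proof -
  have "norm (R Y) \<le> hilbert_schmidt_norm R * norm Y"
    using assms by (rule norm_le_hilbert_schmidt_norm)
  also have "\<dots> \<le> hilbert_schmidt_norm R * (norm g / 4)"
    using norm_perturbation_le one_le by (intro mult_left_mono hilbert_schmidt_norm_nonneg) linarith
  finally have "(norm (R Y))\<^sup>2 \<le> (hilbert_schmidt_norm R * (norm g / 4))\<^sup>2"
    by (rule power_mono) simp
  then have "(norm (R Y))\<^sup>2 \<le> (hilbert_schmidt_norm R)\<^sup>2 * (norm g)\<^sup>2 / 16"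
    by (simp add: power_mult_distrib power_divide)
  moreover have "(hilbert_schmidt_norm R)\<^sup>2 * (norm g)\<^sup>2 / 4
      \<le> area\<^sup>2 * (hilbert_schmidt_norm R)\<^sup>2"
    using mult_right_mono[OF power_mono[OF area_element_bounds(1), of 2],
      of "(hilbert_schmidt_norm R)\<^sup>2"]
    by (simp add: power_divide mult.commute)
  moreover have "0 \<le> (hilbert_schmidt_norm R)\<^sup>2 * (norm g)\<^sup>2" by simp
  ultimately show ?thesis by linarith
qed

end

context mean_curvature_maximum
begin

lemma abs_curvature_error_le:
  assumes large: "large_vector_perturbation g (X z) e L" and contraction: "\<And>h. norm (X h) \<le> norm h"
    and H: "\<bar>H z\<bar> \<le> K" "norm (grad H z) \<le> K" and \<beta>: "0 \<le> \<beta>"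
  shows "\<bar>curvature_error\<bar>
    \<le> (8 * K + 2 * \<beta> * K * defect_bound e L) * norm g ^ 4 + 2 * K * L * norm g ^ 3"
proof -
  interpret large_vector_perturbation g "X z" e L by (rule large)
  define G where "G = norm g"
  have "1 \<le> G" using one_le by (simp add: G_def)
  have "0 \<le> K" using H(1) by linarith
  have area_le: "\<bar>W\<bar> \<le> 2 * G" using area_element_bounds(2) large_area_element_pos
    by (simp add: G_def)
  have "norm (X g) \<le> G\<^sup>2"
    using contraction[of g] self_le_power[OF \<open>1 \<le> G\<close>, of 2] by (simp add: G_def)
  then have "\<bar>H z * W * (X z \<bullet> X g)\<bar> \<le> K * (2 * G) * (L * G\<^sup>2)"
    by (intro abs_mult_le abs_inner_le H area_le perturbation)
  moreover have "\<bar>(grad H z \<bullet> g) * W ^ 3\<bar> \<le> (K * G) * (2 * G) ^ 3"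
    unfolding abs_mult power_abs using area_le \<open>1 \<le> G\<close> \<open>0 \<le> K\<close>
    by (intro mult_mono abs_inner_le H power_mono) (auto simp: G_def)
  moreover have "\<bar>\<beta> * (g \<bullet> g) * H z * W * (W\<^sup>2 - s)\<bar>
    \<le> \<beta> * G\<^sup>2 * K * (2 * G) * (defect_bound e L * G)"
    using area_element_defect
    by (intro abs_mult_le H area_le) (simp_all add: \<beta> G_def power2_norm_eq_inner)
  ultimately have "\<bar>curvature_error\<bar>
      \<le> (K * G) * (2 * G) ^ 3 + \<beta> * G\<^sup>2 * K * (2 * G) * (defect_bound e L * G)
        + K * (2 * G) * (L * G\<^sup>2)"
    unfolding curvature_error_def by linarith
  also have "\<dots> = (8 * K + 2 * \<beta> * K * defect_bound e L) * G ^ 4 + 2 * K * L * G ^ 3" by algebra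
  finally show ?thesis by (simp add: G_def)
qed

lemma abs_coupling_error_le:
  assumes large: "large_vector_perturbation g (X z) e L" and contraction: "\<And>h. norm (X h) \<le> norm h"
    and \<beta>: "0 \<le> \<beta>"
  shows "\<bar>coupling_error\<bar>
    \<le> 8 * \<beta> * L * norm g ^ 3 + (L\<^sup>2 * (4 * \<beta> + 2) + 2 * L) * hilbert_schmidt_norm R * (norm g)\<^sup>2"
proof -
  interpret large_vector_perturbation g "X z" e L by (rule large)
  define G r where "G = norm g" and "r = hilbert_schmidt_norm R"
  have "1 \<le> G" using one_le by (simp add: G_def)
  then have G_le_square: "G \<le> G\<^sup>2" "1 \<le> G\<^sup>2" by (simp_all add: self_le_power)
  have inner_le: "\<bar>g \<bullet> g\<bar> \<le> G\<^sup>2" by (simp add: G_def power2_norm_eq_inner)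
  have ratio_le: "\<bar>s / W\<^sup>2\<bar> \<le> 2" using inner_ratio_bounds by linarith
  have norm_Xg_le: "norm (X g) \<le> G" "norm (X g) \<le> G\<^sup>2"
    using contraction[of g] G_le_square by (simp_all add: G_def)
  have norm_RX_le: "norm (R (X z)) \<le> r * L"
    unfolding r_def by (rule norm_image_perturbation_le[OF linear_reduced_hessian])
  have "\<bar>X z \<bullet> X g / W\<^sup>2\<bar> \<le> G\<^sup>2"
    using inner_perturbation_ratio_le[OF contraction] G_le_square(2) by linarith
  then have "\<bar>2 * (X z \<bullet> R (X z)) * (\<beta> * (g \<bullet> g) * (s / W\<^sup>2) - X z \<bullet> X g / W\<^sup>2)\<bar>
      \<le> 2 * (L * (r * L)) * (\<beta> * G\<^sup>2 * 2 + G\<^sup>2)"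
    by (intro abs_mult_le abs_inner_le perturbation norm_RX_le abs_triangle_ineq4[THEN order_trans]
        add_mono inner_le ratio_le) (simp_all add: \<beta>)
  moreover have "\<bar>2 * \<beta> * (s / W\<^sup>2) * s * (X z \<bullet> X g)\<bar> \<le> 2 * \<beta> * 2 * (2 * G\<^sup>2) * (L * G)"
    using abs_inner_le_twice_square
    by (intro abs_mult_le[OF _ abs_inner_le[OF perturbation norm_Xg_le(1)]] abs_mult_le ratio_le)
      (simp_all add: \<beta> G_def)
  moreover have "\<bar>2 * (X g \<bullet> R (X z))\<bar> \<le> 2 * (G\<^sup>2 * (r * L))"
    by (intro abs_mult_le abs_inner_le norm_RX_le norm_Xg_le) simp
  ultimately have "\<bar>coupling_error\<bar> \<le> 2 * (L * (r * L)) * (\<beta> * G\<^sup>2 * 2 + G\<^sup>2)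
     + 2 * \<beta> * 2 * (2 * G\<^sup>2) * (L * G) + 2 * (G\<^sup>2 * (r * L))"
    unfolding coupling_error_def by linarith
  also have "\<dots> = 8 * \<beta> * L * G ^ 3 + (L\<^sup>2 * (4 * \<beta> + 2) + 2 * L) * r * G\<^sup>2" by algebra
  finally show ?thesis by (simp add: G_def r_def)
qed

end

lemma quartic_absorption:
  fixes G r a b c q :: real
  assumes ineq: "r\<^sup>2 * G\<^sup>2 / 8 + q * G ^ 4 \<le> a * G ^ 4 + b * G ^ 3 + c * r * G\<^sup>2"
    and "a + 1 \<le> q" "1 \<le> G"
  shows "G \<le> b + 2 * c\<^sup>2"
proof -
  have "0 \<le> (r - 4 * c)\<^sup>2 * G\<^sup>2 / 8" by simp
  also have "\<dots> = r\<^sup>2 * G\<^sup>2 / 8 - c * r * G\<^sup>2 + 2 * c\<^sup>2 * G\<^sup>2" by algebra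
  finally have "q * G ^ 4 \<le> a * G ^ 4 + b * G ^ 3 + 2 * c\<^sup>2 * G\<^sup>2" using ineq by linarith
  moreover have "(a + 1) * G ^ 4 \<le> q * G ^ 4" using assms by (intro mult_right_mono) auto
  moreover have "2 * c\<^sup>2 * G\<^sup>2 \<le> 2 * c\<^sup>2 * G ^ 3"
    using \<open>1 \<le> G\<close> by (intro mult_left_mono power_increasing) auto
  ultimately have "G ^ 4 \<le> (b + 2 * c\<^sup>2) * G ^ 3" by (simp add: distrib_right)
  then have "G * G ^ 3 \<le> (b + 2 * c\<^sup>2) * G ^ 3" by (simp add: eval_nat_numeral)
  then show ?thesis using \<open>1 \<le> G\<close> by simp
qed

definition bernstein_exponent :: "real \<Rightarrow> real \<Rightarrow> real \<Rightarrow> real" where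
  "bernstein_exponent e K L = 1 + 2 * (1 + 8 * K + 2 * K * defect_bound e L) / e\<^sup>2"

definition gradient_threshold :: "real \<Rightarrow> real \<Rightarrow> real \<Rightarrow> real" where
  "gradient_threshold e K L = (let \<beta> = bernstein_exponent e K L in
    1 + 16 * defect_bound e L + (8 * \<beta> * L + 2 * K * L) + 2 * (L\<^sup>2 * (4 * \<beta> + 2) + 2 * L)\<^sup>2)"

context
  fixes e K L :: real
  assumes K: "0 \<le> K" and L: "0 \<le> L"
begin

lemma bernstein_exponent_ge_1: "1 \<le> bernstein_exponent e K L"
  using K L by (simp add: bernstein_exponent_def defect_bound_def)

lemma bernstein_exponent_dominates:
  assumes "e \<noteq> 0"
  defines "\<beta> \<equiv> bernstein_exponent e K L"
  shows "8 * K + 2 * \<beta> * K * defect_bound e L + 1 \<le> \<beta>\<^sup>2 * (e\<^sup>2 / 2)"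
proof -
  define m where "m = 2 * K * defect_bound e L"
  have "1 \<le> \<beta>" using bernstein_exponent_ge_1 by (simp add: \<beta>_def)
  have "1 + 8 * K \<le> \<beta> * (1 + 8 * K)" using mult_right_mono[OF \<open>1 \<le> \<beta>\<close>, of "1 + 8 * K"] K by simp
  moreover have "1 + 8 * K + m \<le> \<beta> * (e\<^sup>2 / 2)"
    using \<open>e \<noteq> 0\<close> by (simp add: \<beta>_def bernstein_exponent_def m_def field_simps)
  then have "\<beta> * (1 + 8 * K + m) \<le> \<beta> * (\<beta> * (e\<^sup>2 / 2))"
    using \<open>1 \<le> \<beta>\<close> by (intro mult_left_mono) auto
  ultimately show ?thesis
    by (simp add: m_def power2_eq_square algebra_simps)
qed

lemma gradient_threshold_ge:
  "1 \<le> gradient_threshold e K L" "16 * defect_bound e L \<le> gradient_threshold e K L"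
  "8 * bernstein_exponent e K L * L + 2 * K * L
    + 2 * (L\<^sup>2 * (4 * bernstein_exponent e K L + 2) + 2 * L)\<^sup>2
    \<le> gradient_threshold e K L"
  using K L bernstein_exponent_ge_1 by (auto simp: gradient_threshold_def defect_bound_def Let_def)

end

lemma (in mean_curvature_maximum) norm_gradient_le_threshold:
  assumes contraction: "\<And>h. norm (X h) \<le> norm h" and L: "norm (X z) \<le> L"
    and H: "\<bar>H z\<bar> \<le> K" "norm (grad H z) \<le> K" and \<beta>: "\<beta> = bernstein_exponent e K L"
  shows "norm g \<le> gradient_threshold e K L"
proof (cases "1 \<le> norm g \<and> 16 * defect_bound e L \<le> norm g")
  case True
  then interpret large_vector_perturbation g "X z" e L using L by unfold_locales auto
  have "0 \<le> K" using H(1) by linarith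
  note \<beta>_ge = bernstein_exponent_ge_1[OF \<open>0 \<le> K\<close> L_nonneg, of e, folded \<beta>]
  have "\<beta>\<^sup>2 * (e\<^sup>2 / 2) * norm g ^ 4 \<le> \<beta>\<^sup>2 * (g \<bullet> g) * (W\<^sup>2 * (g \<bullet> g) - s\<^sup>2) * (2 * (s / W\<^sup>2) - 1)"
    using mult_left_mono[OF leading_coefficient_ge, of "\<beta>\<^sup>2 * (norm g)\<^sup>2"]
    by (simp add: power2_norm_eq_inner[symmetric] mult_ac flip: power_add)
  then have quartic_inequality: "(hilbert_schmidt_norm R)\<^sup>2 * (norm g)\<^sup>2 / 8 + \<beta>\<^sup>2 * (e\<^sup>2 / 2) * norm g ^ 4
    \<le> (8 * K + 2 * \<beta> * K * defect_bound e L) * norm g ^ 4 + (8 * \<beta> * L + 2 * K * L) * norm g ^ 3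
      + (L\<^sup>2 * (4 * \<beta> + 2) + 2 * L) * hilbert_schmidt_norm R * (norm g)\<^sup>2"
    using square_term_ge[OF linear_reduced_hessian] bernstein_inequality \<beta>_ge
      abs_curvature_error_le[OF large_vector_perturbation_axioms contraction H]
      abs_coupling_error_le[OF large_vector_perturbation_axioms contraction]
    unfolding distrib_right[of "8 * \<beta> * L"] by linarith
  have "norm g \<le> 8 * \<beta> * L + 2 * K * L + 2 * (L\<^sup>2 * (4 * \<beta> + 2) + 2 * L)\<^sup>2"
    using quartic_inequality bernstein_exponent_dominates[OF \<open>0 \<le> K\<close> L_nonneg e_nonzero, folded \<beta>] one_le
    by (rule quartic_absorption)
  then show ?thesis
    using gradient_threshold_ge(3)[OF \<open>0 \<le> K\<close> L_nonneg, of e, folded \<beta>] by linarith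
next
  case False
  have "0 \<le> K" "0 \<le> L" using H(1) L norm_ge_zero[of "X z"] by linarith+
  then show ?thesis
    using False gradient_threshold_ge(1,2)[of K L e] by linarith
qed

section \<open>The global gradient estimate\<close>

lemma exp_weighted_maximum_principle:
  fixes u :: "'a::heine_borel \<Rightarrow> real" and G :: "'a \<Rightarrow> 'b::real_normed_vector"
  assumes "open \<Omega>" "bounded \<Omega>"
    and cont: "continuous_on (closure \<Omega>) u" "continuous_on (closure \<Omega>) G"
    and u: "\<And>x. x \<in> closure \<Omega> \<Longrightarrow> \<bar>u x\<bar> \<le> M" and "0 \<le> \<beta>"
    and interior: "\<And>x. x \<in> \<Omega> \<Longrightarrow>
      (\<And>y. y \<in> \<Omega> \<Longrightarrow> norm (G y) * exp (\<beta> * u y) \<le> norm (G x) * exp (\<beta> * u x)) \<Longrightarrow> norm (G x) \<le> B"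
    and frontier: "\<And>x. x \<in> frontier \<Omega> \<Longrightarrow> norm (G x) \<le> B"
    and z: "z \<in> closure \<Omega>"
  shows "norm (G z) \<le> exp (2 * \<beta> * M) * B"
proof -
  have compact: "compact (closure \<Omega>)" and nonempty: "closure \<Omega> \<noteq> {}"
    using \<open>bounded \<Omega>\<close> z by auto
  have "continuous_on (closure \<Omega>) (\<lambda>x. norm (G x) * exp (\<beta> * u x))"
    by (intro continuous_intros cont)
  then obtain x where x: "x \<in> closure \<Omega>"
    and max: "\<And>y. y \<in> closure \<Omega> \<Longrightarrow> norm (G y) * exp (\<beta> * u y) \<le> norm (G x) * exp (\<beta> * u x)"
    using continuous_attains_sup[OF compact nonempty] by blast
  have "norm (G x) \<le> B"
  proof (cases "x \<in> \<Omega>")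
    case True
    then show ?thesis using max closure_subset by (intro interior) auto
  next
    case False
    then show ?thesis using x \<open>open \<Omega>\<close> by (intro frontier) (simp add: frontier_def interior_open)
  qed
  have "\<beta> * (u x - u z) \<le> \<beta> * (2 * M)"
    using u[OF x] u[OF z] \<open>0 \<le> \<beta>\<close> by (intro mult_left_mono) auto
  then have exp_le: "exp (\<beta> * (u x - u z)) \<le> exp (2 * \<beta> * M)" by simp
  have "norm (G z) \<le> norm (G x) * exp (\<beta> * (u x - u z))"
    using max[OF z] by (simp add: right_diff_distrib exp_diff pos_le_divide_eq)
  also have "\<dots> \<le> B * exp (2 * \<beta> * M)"
    using \<open>norm (G x) \<le> B\<close> exp_le order_trans[OF norm_ge_zero] by (intro mult_mono) auto
  finally show ?thesis by (simp add: mult.commute)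
qed

lemma bdd_above_norm_image:
  fixes f :: "'a::topological_space \<Rightarrow> 'b::real_normed_vector"
  assumes "compact S" "continuous_on S f" "T \<subseteq> S"
  shows "bdd_above ((\<lambda>x. norm (f x)) ` T)"
proof -
  have "compact ((\<lambda>x. norm (f x)) ` S)"
    using assms by (intro compact_continuous_image continuous_intros) auto
  then have "bdd_above ((\<lambda>x. norm (f x)) ` S)"
    by (intro bounded_imp_bdd_above compact_imp_bounded)
  then show ?thesis using assms(3) by (meson bdd_above_mono image_mono)
qed

lemma norm_le_SUP_norm_on_closure:
  fixes f :: "'a::heine_borel \<Rightarrow> 'b::real_normed_vector"
  assumes "bounded S" "continuous_on (closure S) f" "x \<in> closure S"
  shows "norm (f x) \<le> (SUP x\<in>S. norm (f x))"
proof -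
  have "bdd_above ((\<lambda>x. norm (f x)) ` S)"
    using assms closure_subset by (intro bdd_above_norm_image[of "closure S"]) auto
  then show ?thesis
    using assms by (intro continuous_on_closure_norm_le[of S]) (auto intro: cSUP_upper)
qed

lemma SUP_norm_frontier:
  fixes f :: "'a::euclidean_space \<Rightarrow> 'b::real_normed_vector"
  assumes "bounded S" "S \<noteq> {}" "continuous_on (closure S) f"
  shows "x \<in> frontier S \<Longrightarrow> norm (f x) \<le> (SUP x\<in>frontier S. norm (f x))"
    and "0 \<le> (SUP x\<in>frontier S. norm (f x))"
proof -
  show upper: "norm (f x) \<le> (SUP x\<in>frontier S. norm (f x))" if "x \<in> frontier S" for x
    using assms that
    by (intro cSUP_upper bdd_above_norm_image[of "closure S"]) (auto simp: frontier_def)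
  have "frontier S \<noteq> {}"
    using assms not_bounded_UNIV[where 'a='a] by (auto simp: frontier_eq_empty)
  then show "0 \<le> (SUP x\<in>frontier S. norm (f x))"
    using upper norm_ge_zero order_trans by blast
qed

definition gradient_estimate_constant :: "real \<Rightarrow> real \<Rightarrow> real \<Rightarrow> real \<Rightarrow> real" where
  "gradient_estimate_constant e M K L
    = exp (2 * bernstein_exponent e K L * M) * gradient_threshold e K L"

proposition global_gradient_estimate:
  fixes u H :: "'a::euclidean_space \<Rightarrow> real" and X :: "'a \<Rightarrow> 'a"
  assumes \<Omega>: "open \<Omega>" "bounded \<Omega>" and "e \<noteq> 0"
    and X: "linear X" "\<And>h. X h \<bullet> h = 0" "\<And>h. norm (X h) \<le> norm h" "\<And>x. x \<in> \<Omega> \<Longrightarrow> norm (X x) \<le> L"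
    and H: "H differentiable_on \<Omega>" "\<And>x. x \<in> \<Omega> \<Longrightarrow> \<bar>H x\<bar> \<le> K" "\<And>x. x \<in> \<Omega> \<Longrightarrow> norm (grad H x) \<le> K"
    and u: "Ck_on 3 u \<Omega>" "C1_closure_ext u G \<Omega>" "\<And>x. x \<in> closure \<Omega> \<Longrightarrow> \<bar>u x\<bar> \<le> M"
    and equation: "\<And>x. x \<in> \<Omega> \<Longrightarrow>
      divergence (\<lambda>w. (1 / area_element e (grad u w + X w)) *\<^sub>R (grad u w + X w)) x = H x"
    and z: "z \<in> \<Omega>"
  shows "norm (grad u z)
    \<le> gradient_estimate_constant e M K L * ((SUP x\<in>frontier \<Omega>. norm (G x)) + 1)"
proof -
  define \<beta> \<Lambda> B where "\<beta> = bernstein_exponent e K L" and "\<Lambda> = gradient_threshold e K L"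
    and "B = (SUP x\<in>frontier \<Omega>. norm (G x))"
  have "0 \<le> K" "0 \<le> L" using H(2)[OF z] X(4)[OF z] norm_ge_zero[of "X z"] by linarith+
  then have "0 \<le> \<beta>" "1 \<le> \<Lambda>"
    using bernstein_exponent_ge_1[of K L e] gradient_threshold_ge(1)[of K L e]
    by (simp_all add: \<beta>_def \<Lambda>_def)
  have cont: "continuous_on (closure \<Omega>) u" "continuous_on (closure \<Omega>) G"
    and G: "\<And>x. x \<in> \<Omega> \<Longrightarrow> G x = grad u x"
    using u(2) by (auto simp: C1_closure_ext_def)
  have B: "\<And>x. x \<in> frontier \<Omega> \<Longrightarrow> norm (G x) \<le> B" and "0 \<le> B"
    using SUP_norm_frontier[OF \<open>bounded \<Omega>\<close> _ cont(2)] z by (auto simp: B_def)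
  have interior: "norm (G x) \<le> \<Lambda>" if "x \<in> \<Omega>"
    and "\<And>y. y \<in> \<Omega> \<Longrightarrow> norm (G y) * exp (\<beta> * u y) \<le> norm (G x) * exp (\<beta> * u x)" for x
  proof -
    interpret mean_curvature_maximum u \<Omega> x \<beta> X H e
      using that G \<Omega>(1) u(1) \<open>e \<noteq> 0\<close> X(1,2) H(1) equation
      by (intro mean_curvature_maximum.intro bernstein_maximum.intro
          mean_curvature_maximum_axioms.intro)
        (auto simp: differentiable_on_eq_differentiable_at)
    show ?thesis
      using norm_gradient_le_threshold[OF X(3,4) H(2,3) \<beta>_def] \<open>x \<in> \<Omega>\<close> G by (simp add: \<Lambda>_def)
  qed
  have "norm (G z) \<le> exp (2 * \<beta> * M) * (\<Lambda> * (B + 1))"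
  proof (rule exp_weighted_maximum_principle[OF \<Omega> cont u(3) \<open>0 \<le> \<beta>\<close>])
    have "\<Lambda> \<le> \<Lambda> * (B + 1)" "B \<le> \<Lambda> * (B + 1)"
      using \<open>1 \<le> \<Lambda>\<close> \<open>0 \<le> B\<close> mult_mono[of 1 \<Lambda> B "B + 1"] by (simp_all add: mult_le_cancel_left1)
    then show "norm (G x) \<le> \<Lambda> * (B + 1)" if "x \<in> \<Omega>"
      "\<And>y. y \<in> \<Omega> \<Longrightarrow> norm (G y) * exp (\<beta> * u y) \<le> norm (G x) * exp (\<beta> * u x)" for x
      using interior[OF that] by linarith
    show "norm (G x) \<le> \<Lambda> * (B + 1)" if "x \<in> frontier \<Omega>" for x
      using B[OF that] \<open>B \<le> \<Lambda> * (B + 1)\<close> by linarith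
  qed (use z closure_subset in auto)
  then show ?thesis
    by (simp add: G[OF z] gradient_estimate_constant_def \<beta>_def \<Lambda>_def B_def mult.assoc)
qed

lemma C1_closure_ext_le_SUP:
  assumes "C1_closure_ext H GH \<Omega>" "bounded \<Omega>" "z \<in> \<Omega>"
    and "(SUP z\<in>closure \<Omega>. \<bar>H z\<bar>) + (SUP z\<in>closure \<Omega>. norm (GH z)) \<le> K"
  shows "\<bar>H z\<bar> \<le> K" "norm (grad H z) \<le> K"
proof -
  have cont: "continuous_on (closure \<Omega>) H" "continuous_on (closure \<Omega>) GH" and "GH z = grad H z"
    using assms(1,3) by (auto simp: C1_closure_ext_def)
  have "\<bar>H z\<bar> \<le> (SUP z\<in>closure \<Omega>. \<bar>H z\<bar>)"
    using norm_le_SUP_norm_on_closure[of "closure \<Omega>" H z] cont assms closure_subset by auto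
  moreover have "norm (grad H z) \<le> (SUP z\<in>closure \<Omega>. norm (GH z))"
    using norm_le_SUP_norm_on_closure[of "closure \<Omega>" GH z] cont assms closure_subset
      \<open>GH z = grad H z\<close> by auto
  ultimately show "\<bar>H z\<bar> \<le> K" "norm (grad H z) \<le> K"
    using assms(4) norm_ge_zero[of "grad H z"] by linarith+
qed

corollary scaled_gradient_estimate:
  fixes u H :: "'a::euclidean_space \<Rightarrow> real" and J :: "'a \<Rightarrow> 'a"
  assumes \<Omega>: "open \<Omega>" "bounded \<Omega>" and "e \<noteq> 0" and \<sigma>: "0 \<le> \<sigma>" "\<sigma> \<le> 1"
    and J: "linear J" "\<And>h. J h \<bullet> h = 0" "\<And>h. norm (J h) \<le> norm h"
    and H: "C1_closure_ext H GH \<Omega>" and u: "Ck_on 3 u \<Omega>" "C1_closure_ext u G \<Omega>"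
    and equation: "\<And>x. x \<in> \<Omega> \<Longrightarrow> divergence (\<lambda>w. (1 / area_element e (grad u w + \<sigma> *\<^sub>R J w))
      *\<^sub>R (grad u w + \<sigma> *\<^sub>R J w)) x = \<sigma> * H x"
    and M: "(SUP x\<in>\<Omega>. \<bar>u x\<bar>) \<le> M"
    and K: "(SUP x\<in>closure \<Omega>. \<bar>H x\<bar>) + (SUP x\<in>closure \<Omega>. norm (GH x)) \<le> K"
    and L: "(SUP x\<in>\<Omega>. norm (J x)) \<le> L"
    and z: "z \<in> \<Omega>"
  shows "norm (grad u z)
    \<le> gradient_estimate_constant e M K L * ((SUP x\<in>frontier \<Omega>. norm (G x)) + 1)"
proof (rule global_gradient_estimate[OF \<Omega> \<open>e \<noteq> 0\<close> _ _ _ _ _ _ _ u _ equation z])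
  have scale_le: "\<sigma> * a \<le> b" if "0 \<le> a" "a \<le> b" for a b
    using mult_mono[of \<sigma> 1 a b] \<sigma> that by simp
  have H': "H differentiable (at x)" if "x \<in> \<Omega>" for x
    using H \<open>open \<Omega>\<close> that by (auto simp: C1_closure_ext_def differentiable_on_eq_differentiable_at)
  show "(\<lambda>x. \<sigma> * H x) differentiable_on \<Omega>"
    using H by (simp add: C1_closure_ext_def)
  show "\<bar>\<sigma> * H x\<bar> \<le> K" "norm (grad (\<lambda>x. \<sigma> * H x) x) \<le> K" if "x \<in> \<Omega>" for x
    using C1_closure_ext_le_SUP[OF H \<open>bounded \<Omega>\<close> that K] grad_cmult[OF H'[OF that]] \<sigma>
    by (auto simp: abs_mult intro!: scale_le)
  show "linear (\<lambda>x. \<sigma> *\<^sub>R J x)"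
    by (rule linear_compose_scale_right[OF J(1)])
  show "norm (\<sigma> *\<^sub>R J h) \<le> norm h" for h
    using J(3) \<sigma> by (simp add: scale_le)
  have "continuous_on (closure \<Omega>) J"
    by (intro linear_continuous_on J(1)[unfolded linear_conv_bounded_linear])
  then show "norm (\<sigma> *\<^sub>R J x) \<le> L" if "x \<in> \<Omega>" for x
    using norm_le_SUP_norm_on_closure[OF \<open>bounded \<Omega>\<close>, of J x] subsetD[OF closure_subset that] L \<sigma>
    by (auto intro!: scale_le)
  show "\<bar>u x\<bar> \<le> M" if "x \<in> closure \<Omega>" for x
    using norm_le_SUP_norm_on_closure[OF \<open>bounded \<Omega>\<close>, of u x] u(2) that M
    by (simp add: C1_closure_ext_def)
qed (simp add: J(2))

lemma linear_Xfield: "linear Xfield"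
  by (rule linearI) (simp_all add: Xfield_def prod_eq_iff)

lemma Xfield_skew: "Xfield z \<bullet> z = 0"
  by (simp add: Xfield_def inner_prod_def inner_commute)

lemma norm_Xfield: "norm (Xfield z) = norm z"
  by (simp add: Xfield_def norm_prod_def add.commute)

theorem theorem4p2:
  fixes \<epsilon> M K L :: real
  assumes "\<epsilon> \<noteq> 0"
  shows "\<exists>C>0. \<forall>(\<Omega> :: ((real^'n) \<times> (real^'n)) set) (H :: (real^'n) \<times> (real^'n) \<Rightarrow> real) GH
                  (\<sigma>::real) (u :: (real^'n) \<times> (real^'n) \<Rightarrow> real) G.
      open \<Omega> \<and> connected \<Omega> \<and> \<Omega> \<noteq> {} \<and> bounded \<Omega>
      \<and> C1_closure_ext H GH \<Omega>
      \<and> 0 \<le> \<sigma> \<and> \<sigma> \<le> 1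
      \<and> Ck_on 3 u \<Omega> \<and> C1_closure_ext u G \<Omega>
      \<and> (\<forall>z\<in>\<Omega>. divergence (\<lambda>w. (1 / sqrt (\<epsilon>\<^sup>2 + (norm (grad u w + \<sigma> *\<^sub>R Xfield w))\<^sup>2))
                   *\<^sub>R (grad u w + \<sigma> *\<^sub>R Xfield w)) z = \<sigma> * H z)
      \<and> (SUP z\<in>\<Omega>. \<bar>u z\<bar>) \<le> M
      \<and> (SUP z\<in>closure \<Omega>. \<bar>H z\<bar>) + (SUP z\<in>closure \<Omega>. norm (GH z)) \<le> K
      \<and> (SUP z\<in>\<Omega>. norm (Xfield z)) \<le> L
      \<longrightarrow> (SUP z\<in>\<Omega>. norm (grad u z)) \<le> C * ((SUP z\<in>frontier \<Omega>. norm (G z)) + 1)"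
proof (intro exI conjI allI impI; (elim conjE)?)
  \<comment> \<open>\<open>C\<close> must be positive even when \<open>K\<close> or \<open>L\<close> is negative and the estimate is vacuous.\<close>
  show "0 < gradient_estimate_constant \<epsilon> M \<bar>K\<bar> \<bar>L\<bar>"
    using gradient_threshold_ge(1)[of "\<bar>K\<bar>" "\<bar>L\<bar>" \<epsilon>] by (simp add: gradient_estimate_constant_def)
next
  fix \<Omega> :: "((real^'n) \<times> (real^'n)) set" and H u :: "(real^'n) \<times> (real^'n) \<Rightarrow> real" and GH \<sigma> G
  assume "open \<Omega>" "\<Omega> \<noteq> {}" "bounded \<Omega>" and "C1_closure_ext H GH \<Omega>" and \<sigma>: "0 \<le> \<sigma>" "\<sigma> \<le> 1"
    and "Ck_on 3 u \<Omega>" "C1_closure_ext u G \<Omega>"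
    and equation: "\<forall>z\<in>\<Omega>. divergence (\<lambda>w. (1 / sqrt (\<epsilon>\<^sup>2 + (norm (grad u w + \<sigma> *\<^sub>R Xfield w))\<^sup>2))
      *\<^sub>R (grad u w + \<sigma> *\<^sub>R Xfield w)) z = \<sigma> * H z"
    and "(SUP z\<in>\<Omega>. \<bar>u z\<bar>) \<le> M"
    and K: "(SUP z\<in>closure \<Omega>. \<bar>H z\<bar>) + (SUP z\<in>closure \<Omega>. norm (GH z)) \<le> K"
    and L: "(SUP z\<in>\<Omega>. norm (Xfield z)) \<le> L"
  then have "norm (grad u z)
      \<le> gradient_estimate_constant \<epsilon> M \<bar>K\<bar> \<bar>L\<bar> * ((SUP z\<in>frontier \<Omega>. norm (G z)) + 1)"
    if "z \<in> \<Omega>" for z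
    using assms that bspec[OF equation] order_trans[OF K abs_ge_self] order_trans[OF L abs_ge_self]
    by (intro scaled_gradient_estimate[where J = Xfield and GH = GH])
      (simp_all add: area_element_def linear_Xfield Xfield_skew norm_Xfield)
  then show "(SUP z\<in>\<Omega>. norm (grad u z))
      \<le> gradient_estimate_constant \<epsilon> M \<bar>K\<bar> \<bar>L\<bar> * ((SUP z\<in>frontier \<Omega>. norm (G z)) + 1)"
    using \<open>\<Omega> \<noteq> {}\<close> by (intro cSUP_least)
qed

end
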